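(* The following are equivalent. (1) The Bourgain-Tzafriri Conjecture is true. (2) There are constants $\delta>0$ and $r\in\mathbb{N}$ so that for every $C>0$ there is an $N_0\in\mathbb{N}$ so that for every $N\ge N_0$: if $\{f_i\}_{i=1}^{2N}$ is a unit norm $2$-tight frame for $\mathcal{H}_N$ satisfying $$|f_i(j)|\le \frac{C}{\sqrt{2N}}\quad\text{for all } i=1,\ldots,2N \text{ and } j=1,\ldots,N,$$ then $\{f_i\}_{i=1}^{2N}$ is $(\delta,r)$-Rieszable.
   Context: $\mathcal{H}_N$ denotes an $N$-dimensional (complex) Hilbert space with a fixed orthonormal basis $\{e_j\}_{j=1}^N$, and $f(j)=\langle f,e_j\rangle$ denotes the $j$-th coordinate of a vector $f\in\mathcal{H}_N$. $\ell_2^n$ is the $n$-dimensional (complex) Hilbert space with its standard unit vector basis $\{e_i\}_{i=1}^n$. Bourgain-Tzafriri Conjecture: There is a universal constant $A>0$ so that for every $B>1$ there is a natural number $r=r(B)$ satisfying: for any natural number $n$, if $T:\ell_2^n\to\ell_2^n$ is a linear operator with $\|T\|\le B$ and $\|Te_i\|=1$ for all $i=1,\ldots,n$, then there is a partition $\{A_j\}_{j=1}^r$ of $\{1,\ldots,n\}$ (parts are allowed to be empty) so that for all $j=1,\ldots,r$ and all choices of scalars $\{a_i\}_{i\in A_j}$, $$\Big\|\sum_{i\in A_j}a_iTe_i\Big\|^2\ge A\sum_{i\in A_j}|a_i|^2 .$$ A family $\{f_i\}_{i=1}^M$ in $\mathcal{H}_N$ is a unit norm $2$-tight frame for $\mathcal{H}_N$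 if $\|f_i\|=1$ for all $i$ and $\sum_{i=1}^M|\langle f,f_i\rangle|^2=2\|f\|^2$ for all $f\in\mathcal{H}_N$. A family $\{f_i\}_{i=1}^M$ in $\mathcal{H}_N$ is $(\delta,r)$-Rieszable if there is a partition $\{A_j\}_{j=1}^r$ of $\{1,\ldots,M\}$ (parts are allowed to be empty) so that for all $j=1,\ldots,r$ and all scalars $\{a_i\}_{i\in A_j}$ we have $\|\sum_{i\in A_j}a_if_i\|^2\ge\delta\sum_{i\in A_j}|a_i|^2$. *)

theory Defs
  imports "Jordan_Normal_Form.VS_Connect" "HOL-Library.Disjoint_Sets"
begin

text \<open>The \<open>n\<close>-dimensional complex Hilbert space with its fixed orthonormal basis is modelled as
  \<open>carrier_vec n :: complex vec set\<close> with inner product \<open>\<bullet>c\<close> (conjugate-linear in the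
  second argument) and basis \<open>unit_vec n j\<close>, so \<open>v $ j\<close> is the \<open>j\<close>-th coordinate of \<open>v\<close>.
  Indices run over \<open>{..<n}\<close> rather than \<open>{1..n}\<close>.\<close>

definition hnorm :: "complex vec \<Rightarrow> real" where
  "hnorm v = sqrt (Re (v \<bullet>c v))"

definition linear_operator :: "nat \<Rightarrow> (complex vec \<Rightarrow> complex vec) \<Rightarrow> bool" where
  "linear_operator n T \<longleftrightarrow>
     linear_map class_ring (module_vec TYPE(complex) n) (module_vec TYPE(complex) n) T"

definition operator_norm :: "nat \<Rightarrow> (complex vec \<Rightarrow> complex vec) \<Rightarrow> real" where
  "operator_norm n T = (SUP x \<in> {x \<in> carrier_vec n. hnorm x \<le> 1}. hnorm (T x))"

text \<open>The family is \<open>(f i)\<close> for \<open>i < M\<close> in dimension \<open>N\<close>. The parts \<open>P j\<close> may be empty, which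
  is why \<open>partition_on\<close> is not used.\<close>

definition Rieszable :: "nat \<Rightarrow> nat \<Rightarrow> (nat \<Rightarrow> complex vec) \<Rightarrow> real \<Rightarrow> nat \<Rightarrow> bool" where
  "Rieszable N M f \<delta> r \<longleftrightarrow>
     (\<exists>P :: nat \<Rightarrow> nat set.
        disjoint_family_on P {..<r} \<and> (\<Union>j<r. P j) = {..<M} \<and>
        (\<forall>j<r. \<forall>a :: nat \<Rightarrow> complex.
           (hnorm (finsum_vec TYPE(complex) N (\<lambda>i. a i \<cdot>\<^sub>v f i) (P j)))\<^sup>2
             \<ge> \<delta> * (\<Sum>i\<in>P j. (cmod (a i))\<^sup>2)))"

definition Bourgain_Tzafriri_Conjecture :: bool where
  "Bourgain_Tzafriri_Conjecture \<longleftrightarrow>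
     (\<exists>A::real. A > 0 \<and> (\<forall>B::real. B > 1 \<longrightarrow> (\<exists>r::nat. \<forall>n::nat. \<forall>T.
        linear_operator n T \<and> operator_norm n T \<le> B \<and>
        (\<forall>i<n. hnorm (T (unit_vec n i)) = 1) \<longrightarrow>
        Rieszable n n (\<lambda>i. T (unit_vec n i)) A r)))"

definition unit_norm_2_tight_frame :: "nat \<Rightarrow> nat \<Rightarrow> (nat \<Rightarrow> complex vec) \<Rightarrow> bool" where
  "unit_norm_2_tight_frame N M f \<longleftrightarrow>
     (\<forall>i<M. f i \<in> carrier_vec N \<and> hnorm (f i) = 1) \<and>
     (\<forall>x\<in>carrier_vec N. (\<Sum>i<M. (cmod (x \<bullet>c f i))\<^sup>2) = 2 * (hnorm x)\<^sup>2)"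

end

theory Submission
  imports Defs "Jordan_Normal_Form.Spectral_Radius" "HOL-Analysis.L2_Norm"
begin

text \<open>The conjecture gives the frame property when it is applied to the synthesis operator of the frame,
  whose norm is \<open>\<surd>2\<close> (\<open>BT_imp_tight_frames_Rieszable\<close>).

  For the converse, flatness of the coordinates is first removed. Tensoring a frame with a large
  discrete Fourier matrix makes all its coordinates as small as the frame property demands, and the
  new frame contains an isometric copy of the old one. Hence every unit norm 2-tight frame is
  \<open>(\<delta>, r)\<close>-Rieszable (\<open>flat_frames_imp_all_frames\<close>).

  This is a statement about projections with constant diagonal \<open>1 / 2\<close>, and it passes to arbitrary
  Hermitian contractions \<open>h\<close> with zero diagonal by a dilation: the rows of \<open>(1 + h)\<^sup>1\<^sup>/\<^sup>2\<close> and of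
  \<open>(1 - h)\<^sup>1\<^sup>/\<^sup>2\<close>, taken in an eigenbasis of \<open>h\<close>, form a unit norm 2-tight frame, and the Gram matrix
  of the first half is \<open>1 + h\<close>. The Riesz property thus bounds \<open>h\<close> below by \<open>- (1 - \<delta>)\<close> on each part
  of a partition into \<open>r\<close> parts (\<open>frames_imp_one_sided_paving\<close>).

  Applying this to \<open>h\<close> and to \<open>- h\<close> makes the compressions of \<open>h\<close> to the parts smaller in norm by the
  factor \<open>1 - \<delta>\<close>. They again have zero diagonal, so the argument repeats, and \<open>k\<close> rounds give the
  factor \<open>(1 - \<delta>) ^ k\<close> with \<open>(r * r) ^ k\<close> parts (\<open>iterate_paving\<close>). The Gram matrix of the vectors
  \<open>T e\<^sub>i\<close> differs from the identity by \<open>B\<^sup>2\<close> times such a contraction. With \<open>k\<close> chosen according to \<open>B\<close>,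
  the difference is at most \<open>1 / 2\<close> on every part, which is the conjecture with the universal constant
  \<open>A = 1 / 2\<close> (\<open>paving_imp_BT\<close>).\<close>

section \<open>Orthonormal coefficient systems\<close>

definition sqnorm :: "nat \<Rightarrow> (nat \<Rightarrow> complex) \<Rightarrow> real" where
  "sqnorm n x = (\<Sum>i<n. (cmod (x i))\<^sup>2)"

definition orthonormal_rows :: "nat \<Rightarrow> nat \<Rightarrow> (nat \<Rightarrow> nat \<Rightarrow> complex) \<Rightarrow> bool" where
  "orthonormal_rows m p U \<longleftrightarrow>
     (\<forall>k<m. \<forall>l<m. (\<Sum>t<p. U k t * cnj (U l t)) = of_bool (k = l))"

definition unitary :: "nat \<Rightarrow> (nat \<Rightarrow> nat \<Rightarrow> complex) \<Rightarrow> bool" where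
  "unitary n U \<longleftrightarrow> orthonormal_rows n n U \<and> orthonormal_rows n n (\<lambda>i j. U j i)"

definition hermitian :: "nat \<Rightarrow> (nat \<Rightarrow> nat \<Rightarrow> complex) \<Rightarrow> bool" where
  "hermitian n h \<longleftrightarrow> (\<forall>i<n. \<forall>j<n. h j i = cnj (h i j))"

lemma sqnorm_nonneg [simp]: "0 \<le> sqnorm n x"
  by (simp add: sqnorm_def sum_nonneg)

lemma of_real_sqnorm: "of_real (sqnorm n x) = (\<Sum>i<n. x i * cnj (x i))"
  by (simp only: sqnorm_def of_real_sum complex_norm_square)

lemma sqnorm_scale: "sqnorm n (\<lambda>i. c * x i) = (cmod c)\<^sup>2 * sqnorm n x"
  by (simp add: sqnorm_def norm_mult power_mult_distrib sum_distrib_left)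

lemma sum_of_bool_left:
  fixes f :: "nat \<Rightarrow> complex"
  assumes "l < n"
  shows "(\<Sum>m<n. of_bool (l = m) * f m) = f l" "(\<Sum>m<n. of_bool (m = l) * f m) = f l"
    "(\<Sum>m<n. f m * of_bool (l = m)) = f l" "(\<Sum>m<n. f m * of_bool (m = l)) = f l"
  using assms by (auto simp: of_bool_def if_distrib if_distribR sum.delta' sum.delta cong: if_cong)

text \<open>Expanding both sums leaves the Gram matrix of the rows, which is the identity.\<close>
lemma orthonormal_rows_inner:
  assumes "orthonormal_rows m p U"
  shows "(\<Sum>t<p. (\<Sum>k<m. a k * U k t) * cnj (\<Sum>l<m. b l * U l t)) = (\<Sum>k<m. a k * cnj (b k))"
proof -
  have "(\<Sum>t<p. (\<Sum>k<m. a k * U k t) * cnj (\<Sum>l<m. b l * U l t))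
      = (\<Sum>t<p. \<Sum>k<m. \<Sum>l<m. a k * cnj (b l) * (U k t * cnj (U l t)))"
    by (simp add: sum_product cnj_sum mult_ac)
  also have "\<dots> = (\<Sum>k<m. \<Sum>t<p. \<Sum>l<m. a k * cnj (b l) * (U k t * cnj (U l t)))"
    by (rule sum.swap)
  also have "\<dots> = (\<Sum>k<m. \<Sum>l<m. a k * cnj (b l) * (\<Sum>t<p. U k t * cnj (U l t)))"
    by (subst sum.swap) (simp add: sum_distrib_left)
  also have "\<dots> = (\<Sum>k<m. \<Sum>l<m. a k * cnj (b l) * of_bool (k = l))"
    using assms by (intro sum.cong refl) (simp add: orthonormal_rows_def)
  also have "\<dots> = (\<Sum>k<m. a k * cnj (b k))"
    by (intro sum.cong refl) (simp add: sum_of_bool_left)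
  finally show ?thesis .
qed

lemma parseval:
  assumes "orthonormal_rows m p U"
  shows "(\<Sum>t<p. (cmod (\<Sum>k<m. a k * U k t))\<^sup>2) = sqnorm m a"
proof -
  have "complex_of_real (\<Sum>t<p. (cmod (\<Sum>k<m. a k * U k t))\<^sup>2) = of_real (sqnorm m a)"
    using orthonormal_rows_inner[OF assms, of a a]
    by (simp only: of_real_sum complex_norm_square of_real_sqnorm)
  thus ?thesis by (simp only: of_real_eq_iff)
qed

lemma orthonormal_rows_cnj:
  assumes "orthonormal_rows m p U" shows "orthonormal_rows m p (\<lambda>i j. cnj (U i j))"
  unfolding orthonormal_rows_def
proof (intro allI impI)
  fix k l assume "k < m" "l < m"
  hence "(\<Sum>t<p. U l t * cnj (U k t)) = of_bool (l = k)"
    using assms by (simp add: orthonormal_rows_def)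
  thus "(\<Sum>t<p. cnj (U k t) * cnj (cnj (U l t))) = of_bool (k = l)"
    by (simp only: complex_cnj_cnj mult.commute[of "cnj (U k _)"] eq_commute[of k l])
qed

lemma unitary_mult:
  assumes "unitary n U" "unitary n V"
  shows "unitary n (\<lambda>i j. \<Sum>k<n. U i k * V k j)"
  unfolding unitary_def
proof
  have U: "orthonormal_rows n n U" "orthonormal_rows n n (\<lambda>i j. U j i)"
    and V: "orthonormal_rows n n V" "orthonormal_rows n n (\<lambda>i j. V j i)"
    using assms by (auto simp: unitary_def)
  show "orthonormal_rows n n (\<lambda>i j. \<Sum>k<n. U i k * V k j)"
    using U(1) unfolding orthonormal_rows_def[of n n "\<lambda>i j. \<Sum>k<n. U i k * V k j"]
    by (simp only: orthonormal_rows_inner[OF V(1)]) (simp add: orthonormal_rows_def)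
  show "orthonormal_rows n n (\<lambda>i j. \<Sum>k<n. U j k * V k i)"
    using V(2) unfolding orthonormal_rows_def[of n n "\<lambda>i j. \<Sum>k<n. U j k * V k i"]
    by (simp only: mult.commute[of "U _ _"] orthonormal_rows_inner[OF U(2)])
      (simp add: orthonormal_rows_def)
qed

section \<open>The spectral theorem for Hermitian matrices\<close>

text \<open>The Householder reflection along \<open>w = v - e\<^sub>n\<close> exchanges \<open>e\<^sub>n\<close> and \<open>v\<close>, so it is the required
  unitary. The exchange needs the inner product of the two vectors to be real, and \<open>w \<noteq> 0\<close> needs
  it to differ from \<open>1\<close>; the conditions on \<open>v n\<close> secure both.\<close>
lemma unitary_with_last_column:
  assumes v: "sqnorm (Suc n) v = 1" and re: "Im (v n) = 0" "Re (v n) \<le> 0"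
  shows "\<exists>W. unitary (Suc n) W \<and> (\<forall>i<Suc n. W i n = v i)"
proof -
  let ?N = "Suc n"
  define w where "w i = v i - of_bool (i = n)" for i
  \<comment> \<open>the squared norm of \<open>w\<close>\<close>
  define s where "s = 2 - 2 * v n"
  have vn: "cnj (v n) = v n" using re by (simp add: complex_eq_iff)
  have s0: "s \<noteq> 0" using re by (auto simp: s_def complex_eq_iff)
  have cs: "cnj s = s" by (simp add: s_def vn)
  have "(\<Sum>i<?N. v i * cnj (v i)) = 1"
    using v of_real_sqnorm[of ?N v] by simp
  hence "(\<Sum>i<n. v i * cnj (v i)) + v n * v n = 1" by (simp add: vn)
  moreover have "(\<Sum>i<n. w i * cnj (w i)) = (\<Sum>i<n. v i * cnj (v i))"
    by (intro sum.cong refl) (simp add: w_def)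
  ultimately have ws: "(\<Sum>i<?N. w i * cnj (w i)) = s"
    by (simp add: w_def s_def vn algebra_simps)
  define c where "c = 2 / s"
  have c: "c * c * s = 2 * c" "cnj c = c" using s0 by (simp_all add: c_def cs)
  define W where "W i k = of_bool (i = k) - c * w i * cnj (w k)" for i k
  have sym: "cnj (W i k) = W k i" for i k
    by (simp add: W_def c(2) mult_ac eq_commute)
  have sq: "(\<Sum>t<?N. W i t * W t j) = of_bool (i = j)" if "i < ?N" "j < ?N" for i j
  proof -
    have "(\<Sum>t<?N. W i t * W t j)
        = (\<Sum>t<?N. of_bool (i = t) * (of_bool (t = j) - c * w t * cnj (w j))
            - of_bool (t = j) * (c * w i * cnj (w t))
            + c * c * w i * cnj (w j) * (w t * cnj (w t)))"
      by (intro sum.cong refl) (simp only: W_def ring_distribs mult_ac diff_conv_add_uminus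
          minus_mult_left[symmetric] minus_mult_right[symmetric] add_ac minus_add_distrib minus_minus)
    also have "\<dots> = of_bool (i = j) - c * w i * cnj (w j) - c * w i * cnj (w j)
            + c * c * w i * cnj (w j) * s"
      by (simp only: sum.distrib sum_subtractf sum_of_bool_left[OF that(1)]
          sum_of_bool_left[OF that(2)] sum_distrib_left[symmetric] ws)
    also have "\<dots> = of_bool (i = j) - 2 * c * w i * cnj (w j) + (c * c * s) * w i * cnj (w j)"
      by (simp add: algebra_simps)
    also have "\<dots> = of_bool (i = j)" by (simp add: c(1))
    finally show ?thesis .
  qed
  have sq': "(\<Sum>t<?N. W t i * W j t) = of_bool (i = j)" if "i < ?N" "j < ?N" for i j
    using sq[OF that(2,1)] by (simp only: mult.commute eq_commute[of i j])
  have "unitary ?N W"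
    unfolding unitary_def orthonormal_rows_def sym using sq sq' by blast
  moreover have "W i n = v i" if "i < ?N" for i
  proof -
    have "c * cnj (w n) = - 1"
      using s0 by (simp add: w_def vn c_def s_def field_simps)
    hence "c * w i * cnj (w n) = - w i" by (simp add: mult.assoc mult.left_commute[of c])
    thus ?thesis by (simp add: W_def) (simp add: w_def)
  qed
  ultimately show ?thesis by blast
qed

text \<open>A root of the characteristic polynomial gives an eigenvector; scaling brings it into the
  normalised form from which a Householder reflection can be built.\<close>
lemma exists_unit_eigenvector:
  fixes h :: "nat \<Rightarrow> nat \<Rightarrow> complex"
  shows "\<exists>v e. sqnorm (Suc n) v = 1 \<and> Im (v n) = 0 \<and> Re (v n) \<le> 0 \<and>
     (\<forall>i<Suc n. (\<Sum>j<Suc n. h i j * v j) = e * v i)"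
proof -
  let ?N = "Suc n"
  define A where "A = mat ?N ?N (\<lambda>(i, j). h i j)"
  have A: "A \<in> carrier_mat ?N ?N" by (simp add: A_def)
  obtain e where "e \<in> spectrum A" using spectrum_non_empty[OF A] by auto
  then obtain u where u: "u \<in> carrier_vec ?N" "u \<noteq> 0\<^sub>v ?N" "A *\<^sub>v u = e \<cdot>\<^sub>v u"
    using A by (auto simp: spectrum_def eigenvalue_def eigenvector_def)
  have ev: "(\<Sum>j<?N. h i j * u $ j) = e * u $ i" if "i < ?N" for i
  proof -
    have "(A *\<^sub>v u) $ i = (\<Sum>j<?N. h i j * u $ j)"
      using that u(1) A by (auto simp: A_def scalar_prod_def atLeast0LessThan intro!: sum.cong)
    thus ?thesis using that u by simp
  qed
  define q where "q = sqrt (sqnorm ?N (($) u))"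
  obtain i where i: "i < ?N" "u $ i \<noteq> 0"
    using u(1,2) by (metis carrier_vecD eq_vecI index_zero_vec(1) index_zero_vec(2))
  have "0 < (cmod (u $ i))\<^sup>2" using i by simp
  also have "\<dots> \<le> sqnorm ?N (($) u)"
    unfolding sqnorm_def using i(1) by (intro member_le_sum) auto
  finally have q: "q > 0" "q\<^sup>2 = sqnorm ?N (($) u)" by (auto simp: q_def)
  \<comment> \<open>Multiplying by \<open>c\<close> normalises \<open>u\<close> and turns its last entry into a nonpositive real.\<close>
  define c where "c = (if u $ n = 0 then 1 else - cnj (u $ n) / of_real (cmod (u $ n))) / of_real q"
  have c: "cmod c = 1 / q" using q by (simp add: c_def norm_divide)
  have "c * u $ n = of_real (- cmod (u $ n) / q)"
  proof (cases "u $ n = 0")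
    case False
    have "cnj (u $ n) * (u $ n) = of_real (cmod (u $ n)) * of_real (cmod (u $ n))"
      using complex_norm_square[of "u $ n"] by (simp add: power2_eq_square mult.commute)
    thus ?thesis using False q by (simp add: c_def field_simps)
  qed simp
  hence "Im (c * u $ n) = 0" "Re (c * u $ n) \<le> 0" using q by (auto simp del: times_complex.sel)
  moreover have "sqnorm ?N (\<lambda>i. c * u $ i) = 1"
    unfolding sqnorm_scale c q(2)[symmetric] using q(1) by (simp add: power_divide)
  moreover have "(\<Sum>j<?N. h i j * (c * u $ j)) = e * (c * u $ i)" if "i < ?N" for i
    using ev[OF that] by (simp only: mult.left_commute[of _ c] sum_distrib_left[symmetric])
  ultimately show ?thesis by (intro exI[of _ "\<lambda>i. c * u $ i"] exI[of _ e]) blast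
qed

lemma hermitian_eigenvalue_real:
  assumes h: "hermitian n h" and v: "sqnorm n v = 1"
    and ev: "\<And>i. i < n \<Longrightarrow> (\<Sum>j<n. h i j * v j) = e * v i"
  shows "cnj e = e"
proof -
  have e: "(\<Sum>i<n. \<Sum>j<n. cnj (v i) * h i j * v j) = e"
  proof -
    have "(\<Sum>i<n. \<Sum>j<n. cnj (v i) * h i j * v j) = (\<Sum>i<n. cnj (v i) * (\<Sum>j<n. h i j * v j))"
      by (simp add: sum_distrib_left mult.assoc)
    also have "\<dots> = (\<Sum>i<n. e * (v i * cnj (v i)))"
      by (intro sum.cong refl) (simp only: lessThan_iff ev, simp only: mult_ac)
    also have "\<dots> = e"
      using v by (simp add: sum_distrib_left[symmetric] of_real_sqnorm[symmetric])
    finally show ?thesis .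
  qed
  have hc: "cnj (h i j) = h j i" if "i < n" "j < n" for i j
    using h that unfolding hermitian_def by metis
  have "cnj e = (\<Sum>i<n. \<Sum>j<n. cnj (v j) * h j i * v i)"
  proof -
    have "cnj e = (\<Sum>i<n. \<Sum>j<n. cnj (cnj (v i) * h i j * v j))"
      by (subst e[symmetric]) (simp only: cnj_sum)
    also have "\<dots> = (\<Sum>i<n. \<Sum>j<n. v i * h j i * cnj (v j))"
      by (intro sum.cong refl) (simp only: lessThan_iff complex_cnj_mult complex_cnj_cnj hc)
    finally show ?thesis by (simp only: mult_ac)
  qed
  also have "\<dots> = (\<Sum>j<n. \<Sum>i<n. cnj (v j) * h j i * v i)"
    by (rule sum.swap)
  also have "\<dots> = e" by (rule e)
  finally show ?thesis .
qed

lemma unitary_extend: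
  assumes "unitary n V"
  shows "unitary (Suc n) (\<lambda>k m. if k < n \<and> m < n then V k m else of_bool (k = m))" (is "unitary _ ?V")
proof -
  have cut: "(\<Sum>t<n. ?V k t * cnj (?V l t)) =
      (if k < n \<and> l < n then \<Sum>t<n. V k t * cnj (V l t) else 0)"
    "(\<Sum>t<n. ?V t k * cnj (?V t l)) =
      (if k < n \<and> l < n then \<Sum>t<n. V t k * cnj (V t l) else 0)"
    if "k < Suc n" "l < Suc n" for k l
    using that by (auto intro!: sum.cong sum.neutral)
  show ?thesis
    using assms unfolding unitary_def orthonormal_rows_def
    by (auto simp: cut less_Suc_eq)
qed

text \<open>Induction on the size. A reflection \<open>W\<close> whose last column is a unit eigenvector turns \<open>h\<close> into
  the Hermitian matrix \<open>B = W\<^sup>* h W\<close>, whose last row and column vanish off the diagonal. The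
  induction hypothesis diagonalises the remaining block of \<open>B\<close>, and multiplying the result by
  \<open>W\<close> diagonalises \<open>h\<close>.\<close>
lemma hermitian_diagonalization:
  assumes "hermitian n h"
  shows "\<exists>U d. unitary n U \<and> (\<forall>i<n. \<forall>m<n. (\<Sum>j<n. h i j * U j m) = of_real (d m) * U i m)"
  using assms
proof (induction n arbitrary: h)
  case 0
  show ?case by (auto simp: unitary_def orthonormal_rows_def)
next
  case (Suc n)
  let ?N = "Suc n"
  obtain v e where v: "sqnorm ?N v = 1" "Im (v n) = 0" "Re (v n) \<le> 0"
    and ev: "\<And>i. i < ?N \<Longrightarrow> (\<Sum>j<?N. h i j * v j) = e * v i"
    using exists_unit_eigenvector[of n h] by blast
  have er: "cnj e = e" using hermitian_eigenvalue_real[OF Suc.prems v(1) ev] .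
  obtain W where W: "unitary ?N W" and Wn: "\<And>i. i < ?N \<Longrightarrow> W i n = v i"
    using unitary_with_last_column[OF v] by blast
  define hW where "hW i k = (\<Sum>j<?N. h i j * W j k)" for i k
  define B where "B l k = (\<Sum>p<?N. cnj (W p l) * hW p k)" for l k
  have hW_eq: "hW i k = (\<Sum>l<?N. W i l * B l k)" if "i < ?N" for i k
  proof -
    have "(\<Sum>l<?N. W i l * B l k) = (\<Sum>l<?N. \<Sum>p<?N. (W i l * cnj (W p l)) * hW p k)"
      by (simp only: B_def sum_distrib_left mult.assoc)
    also have "\<dots> = (\<Sum>p<?N. (\<Sum>l<?N. W i l * cnj (W p l)) * hW p k)"
      by (subst sum.swap) (simp only: sum_distrib_right)
    also have "\<dots> = (\<Sum>p<?N. of_bool (i = p) * hW p k)"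
      using W that by (intro sum.cong refl) (simp only: unitary_def orthonormal_rows_def lessThan_iff)
    finally show ?thesis using that by (simp only: sum_of_bool_left)
  qed
  have hc: "cnj (h i j) = h j i" if "i < ?N" "j < ?N" for i j
    using Suc.prems that unfolding hermitian_def by metis
  have Bherm: "B k l = cnj (B l k)" for k l
  proof -
    have "cnj (B l k) = (\<Sum>p<?N. \<Sum>q<?N. W p l * (cnj (h p q) * cnj (W q k)))"
      by (simp only: B_def hW_def cnj_sum complex_cnj_mult complex_cnj_cnj sum_distrib_left)
    also have "\<dots> = (\<Sum>p<?N. \<Sum>q<?N. cnj (W q k) * (h q p * W p l))"
      by (intro sum.cong refl) (simp add: hc mult_ac)
    also have "\<dots> = B k l"
      by (subst sum.swap) (simp only: B_def hW_def sum_distrib_left)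
    finally show ?thesis ..
  qed
  have Bn: "B l n = e * of_bool (l = n)" if "l < ?N" for l
  proof -
    have "hW p n = e * W p n" if "p < ?N" for p
    proof -
      have "hW p n = (\<Sum>j<?N. h p j * v j)"
        unfolding hW_def by (intro sum.cong refl) (simp only: lessThan_iff Wn)
      thus ?thesis using ev[OF that] Wn[OF that] by simp
    qed
    hence "B l n = (\<Sum>p<?N. e * (W p n * cnj (W p l)))"
      unfolding B_def by (intro sum.cong refl) (simp only: lessThan_iff mult_ac)
    also have "\<dots> = e * of_bool (n = l)"
      using W that by (simp only: sum_distrib_left[symmetric] unitary_def orthonormal_rows_def)
    finally show ?thesis by (simp add: eq_commute)
  qed
  have nB: "B n l = e * of_bool (l = n)" if "l < ?N" for l
    using Bherm[of n l] Bn[OF that] by (simp add: er)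
  have "hermitian n B" unfolding hermitian_def using Bherm by blast
  then obtain V d where V: "unitary n V"
    and Vd: "\<And>i m. i < n \<Longrightarrow> m < n \<Longrightarrow> (\<Sum>j<n. B i j * V j m) = of_real (d m) * V i m"
    using Suc.IH by blast
  define V' where "V' k m = (if k < n \<and> m < n then V k m else of_bool (k = m))" for k m
  define d' where "d' m = (if m < n then d m else Re e)" for m
  have ee: "of_real (Re e) = e" using er by (simp add: complex_eq_iff)
  have V'd: "(\<Sum>k<?N. B l k * V' k m) = of_real (d' m) * V' l m" if "l < ?N" "m < ?N" for l m
  proof (cases "m < n")
    case True
    have *: "(\<Sum>k<n. B l k * V' k m) = (\<Sum>k<n. B l k * V k m)"
      by (intro sum.cong refl) (simp add: V'_def True)
    have z: "B n k = 0" if "k < n" for k using nB[of k] that by simp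
    show ?thesis
    proof (cases "l < n")
      case True
      thus ?thesis using \<open>m < n\<close> * Vd[OF True \<open>m < n\<close>] by (simp add: V'_def d'_def)
    next
      case False
      hence "l = n" using that by simp
      thus ?thesis using \<open>m < n\<close> z unfolding sum.lessThan_Suc * by (simp add: V'_def)
    qed
  next
    case False
    hence m: "m = n" using that by simp
    have "(\<Sum>k<n. B l k * V' k n) = 0" by (intro sum.neutral) (simp add: V'_def)
    thus ?thesis using Bn[OF that(1)] by (simp add: m V'_def d'_def ee)
  qed
  define U where "U i m = (\<Sum>k<?N. W i k * V' k m)" for i m
  have "unitary ?N V'" unfolding V'_def by (rule unitary_extend[OF V])
  hence "unitary ?N U" unfolding U_def by (rule unitary_mult[OF W])
  moreover have "(\<Sum>j<?N. h i j * U j m) = of_real (d' m) * U i m" if "i < ?N" "m < ?N" for i m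
  proof -
    have "(\<Sum>j<?N. h i j * U j m) = (\<Sum>k<?N. hW i k * V' k m)"
      unfolding U_def hW_def sum_distrib_left sum_distrib_right
      by (subst sum.swap) (simp only: mult.assoc)
    also have "\<dots> = (\<Sum>k<?N. \<Sum>l<?N. W i l * (B l k * V' k m))"
      by (simp only: hW_eq[OF that(1)] sum_distrib_right mult.assoc)
    also have "\<dots> = (\<Sum>l<?N. W i l * (\<Sum>k<?N. B l k * V' k m))"
      by (subst sum.swap) (simp only: sum_distrib_left)
    also have "\<dots> = (\<Sum>l<?N. of_real (d' m) * (W i l * V' l m))"
      by (intro sum.cong refl) (simp only: lessThan_iff V'd[OF _ that(2)] mult.left_commute)
    finally show ?thesis by (simp only: U_def sum_distrib_left)
  qed
  ultimately show ?case by blast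
qed

lemma spectral_decomposition:
  assumes "hermitian n h"
  obtains U d where "unitary n U"
    "\<And>i j. i < n \<Longrightarrow> j < n \<Longrightarrow> h i j = (\<Sum>m<n. of_real (d m) * U i m * cnj (U j m))"
proof -
  obtain U d where U: "unitary n U"
    and ev: "\<forall>i<n. \<forall>m<n. (\<Sum>j<n. h i j * U j m) = of_real (d m) * U i m"
    using hermitian_diagonalization[OF assms] by blast
  have "h i j = (\<Sum>m<n. of_real (d m) * U i m * cnj (U j m))" if ij: "i < n" "j < n" for i j
  proof -
    have "(\<Sum>m<n. of_real (d m) * U i m * cnj (U j m)) = (\<Sum>m<n. (\<Sum>l<n. h i l * U l m) * cnj (U j m))"
      using ev ij by (intro sum.cong refl) simp
    also have "\<dots> = (\<Sum>l<n. h i l * (\<Sum>m<n. U l m * cnj (U j m)))"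
      unfolding sum_distrib_left sum_distrib_right by (subst sum.swap) (simp only: mult.assoc)
    also have "\<dots> = (\<Sum>l<n. h i l * of_bool (l = j))"
      using U ij by (intro sum.cong refl) (simp only: unitary_def orthonormal_rows_def lessThan_iff)
    finally show ?thesis using ij by (simp only: sum_of_bool_left)
  qed
  thus ?thesis using that U by blast
qed

section \<open>Quadratic forms and colourings\<close>

definition qform :: "nat \<Rightarrow> (nat \<Rightarrow> nat \<Rightarrow> complex) \<Rightarrow> (nat \<Rightarrow> complex) \<Rightarrow> real" where
  "qform n h x = Re (\<Sum>i<n. \<Sum>j<n. h i j * x i * cnj (x j))"

text \<open>The squared norm of the linear combination of the vectors \<open>F 0, \<dots>, F (M - 1)\<close> with coefficients \<open>x\<close>.\<close>
definition energy :: "nat \<Rightarrow> nat \<Rightarrow> (nat \<Rightarrow> nat \<Rightarrow> complex) \<Rightarrow> (nat \<Rightarrow> complex) \<Rightarrow> real" where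
  "energy N M F x = (\<Sum>k<N. (cmod (\<Sum>i<M. x i * F i k))\<^sup>2)"

text \<open>Colourings replace partitions, and a family of scalars indexed by one part becomes a vector of
  full length that vanishes off one colour class. Common refinements are then colourings by pairs,
  and no index set ever has to be renumbered.\<close>
definition monochromatic :: "nat \<Rightarrow> (nat \<Rightarrow> nat) \<Rightarrow> (nat \<Rightarrow> complex) \<Rightarrow> bool" where
  "monochromatic M c x \<longleftrightarrow> (\<exists>t. \<forall>i<M. c i \<noteq> t \<longrightarrow> x i = 0)"

definition Riesz_colourable :: "nat \<Rightarrow> nat \<Rightarrow> (nat \<Rightarrow> nat \<Rightarrow> complex) \<Rightarrow> real \<Rightarrow> nat \<Rightarrow> bool" where
  "Riesz_colourable N M F \<delta> r \<longleftrightarrow> (\<exists>c. (\<forall>i<M. c i < r) \<and>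
     (\<forall>x. monochromatic M c x \<longrightarrow> \<delta> * sqnorm M x \<le> energy N M F x))"

text \<open>Unit norm 2-tight frames as arrays of coordinates.\<close>
definition tight2 :: "nat \<Rightarrow> nat \<Rightarrow> (nat \<Rightarrow> nat \<Rightarrow> complex) \<Rightarrow> bool" where
  "tight2 N M F \<longleftrightarrow> (\<forall>i<M. sqnorm N (F i) = 1) \<and>
     (\<forall>x. (\<Sum>i<M. (cmod (\<Sum>k<N. x k * cnj (F i k)))\<^sup>2) = 2 * sqnorm N x)"

lemma qform_diagonalized:
  assumes "\<And>i j. i < n \<Longrightarrow> j < n \<Longrightarrow> h i j = (\<Sum>m<p. of_real (d m) * U i m * cnj (U j m))"
  shows "qform n h x = (\<Sum>m<p. d m * (cmod (\<Sum>i<n. x i * U i m))\<^sup>2)"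
proof -
  have "(\<Sum>i<n. \<Sum>j<n. h i j * x i * cnj (x j))
      = (\<Sum>i<n. \<Sum>j<n. \<Sum>m<p. of_real (d m) * ((x i * U i m) * cnj (x j * U j m)))"
    using assms by (intro sum.cong refl) (simp add: sum_distrib_left sum_distrib_right mult_ac)
  also have "\<dots> = (\<Sum>i<n. \<Sum>m<p. \<Sum>j<n. of_real (d m) * ((x i * U i m) * cnj (x j * U j m)))"
    by (intro sum.cong refl sum.swap)
  also have "\<dots> = (\<Sum>m<p. \<Sum>i<n. \<Sum>j<n. of_real (d m) * ((x i * U i m) * cnj (x j * U j m)))"
    by (rule sum.swap)
  also have "\<dots> = (\<Sum>m<p. of_real (d m) * ((\<Sum>i<n. x i * U i m) * cnj (\<Sum>j<n. x j * U j m)))"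
    by (simp only: sum_product cnj_sum, simp only: sum_distrib_left)
  also have "\<dots> = of_real (\<Sum>m<p. d m * (cmod (\<Sum>i<n. x i * U i m))\<^sup>2)"
    by (simp only: of_real_sum of_real_mult complex_norm_square)
  finally show ?thesis by (simp only: qform_def Re_complex_of_real)
qed

lemma qform_id: "qform n (\<lambda>i j. of_bool (i = j)) x = sqnorm n x"
proof -
  have "(\<Sum>i<n. \<Sum>j<n. of_bool (i = j) * x i * cnj (x j)) = of_real (sqnorm n x)"
    unfolding of_real_sqnorm mult.assoc by (intro sum.cong refl) (simp only: sum_of_bool_left lessThan_iff)
  thus ?thesis by (simp only: qform_def Re_complex_of_real)
qed

lemma qform_diff: "qform n (\<lambda>i j. g i j - h i j) x = qform n g x - qform n h x"
  by (simp add: qform_def left_diff_distrib sum_subtractf)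

lemma qform_scale: "qform n (\<lambda>i j. of_real s * h i j) x = s * qform n h x"
proof -
  have "(\<Sum>i<n. \<Sum>j<n. of_real s * h i j * x i * cnj (x j))
      = of_real s * (\<Sum>i<n. \<Sum>j<n. h i j * x i * cnj (x j))"
    by (simp only: sum_distrib_left mult.assoc)
  thus ?thesis by (simp only: qform_def) simp
qed

text \<open>The block diagonal part of \<open>h\<close> acts on each colour class separately. This is what lets a paving
  result be applied to all blocks of a colouring at once.\<close>
lemma colour_classes_sum:
  assumes c: "\<And>i. i < n \<Longrightarrow> c i < (R::nat)"
  shows "qform n (\<lambda>i j. if c i = c j then h i j else 0) x
      = (\<Sum>t<R. qform n h (\<lambda>i. if c i = t then x i else 0))" (is ?A)
    and "sqnorm n x = (\<Sum>t<R. sqnorm n (\<lambda>i. if c i = t then x i else 0))" (is ?B)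
proof -
  have "(\<Sum>t<R. \<Sum>i<n. \<Sum>j<n. h i j * (if c i = t then x i else 0) * cnj (if c j = t then x j else 0))
      = (\<Sum>i<n. \<Sum>t<R. \<Sum>j<n. h i j * (if c i = t then x i else 0) * cnj (if c j = t then x j else 0))"
    by (rule sum.swap)
  also have "\<dots> = (\<Sum>i<n. \<Sum>j<n. \<Sum>t<R. h i j * (if c i = t then x i else 0) * cnj (if c j = t then x j else 0))"
    by (intro sum.cong refl sum.swap)
  also have "\<dots> = (\<Sum>i<n. \<Sum>j<n. \<Sum>t<R. if t = c i then (if c i = c j then h i j else 0) * x i * cnj (x j) else 0)"
    by (intro sum.cong refl) auto
  also have "\<dots> = (\<Sum>i<n. \<Sum>j<n. (if c i = c j then h i j else 0) * x i * cnj (x j))"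
    using c by (intro sum.cong refl) (simp add: sum.delta)
  finally show ?A by (simp only: qform_def Re_sum[symmetric])
next
  have "(\<Sum>t<R. sqnorm n (\<lambda>i. if c i = t then x i else 0))
      = (\<Sum>i<n. \<Sum>t<R. if t = c i then (cmod (x i))\<^sup>2 else 0)"
    unfolding sqnorm_def by (subst sum.swap) (intro sum.cong refl, auto)
  also have "\<dots> = sqnorm n x"
    using c unfolding sqnorm_def by (intro sum.cong refl) (simp add: sum.delta)
  finally show ?B ..
qed

section \<open>Paving by iteration\<close>

text \<open>A contraction with zero diagonal satisfies only \<open>qform n h x \<ge> - sqnorm n x\<close>; the property says
  that on the classes of a colouring with boundedly many colours the constant improves uniformly to
  some \<open>\<epsilon> < 1\<close>. The bound is one-sided, as is the one that the Riesz property yields.\<close>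
definition one_sided_paving :: "real \<Rightarrow> nat \<Rightarrow> bool" where
  "one_sided_paving \<epsilon> r \<longleftrightarrow> (\<forall>n h. hermitian n h \<longrightarrow> (\<forall>i<n. h i i = 0) \<longrightarrow>
     (\<forall>x. \<bar>qform n h x\<bar> \<le> sqnorm n x) \<longrightarrow>
     (\<exists>c. (\<forall>i<n. c i < r) \<and> (\<forall>x. monochromatic n c x \<longrightarrow> - \<epsilon> * sqnorm n x \<le> qform n h x)))"

lemma monochromatic_const:
  assumes "monochromatic n c x"
  obtains t where "\<And>i. i < n \<Longrightarrow> c i \<noteq> t \<Longrightarrow> x i = 0"
  using assms by (auto simp: monochromatic_def)

lemma qform_mask:
  assumes "monochromatic n c x"
  shows "qform n (\<lambda>i j. if c i = c j then h i j else 0) x = qform n h x"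
proof -
  obtain t where t: "\<And>i. i < n \<Longrightarrow> c i \<noteq> t \<Longrightarrow> x i = 0"
    using assms by (rule monochromatic_const) blast
  have "(if c i = c j then h i j else 0) * x i * cnj (x j) = h i j * x i * cnj (x j)"
    if "i < n" "j < n" for i j
    using t[OF that(1)] t[OF that(2)] by (cases "c i = t"; cases "c j = t") auto
  thus ?thesis unfolding qform_def by (intro arg_cong[of _ _ Re] sum.cong refl) simp
qed

text \<open>Given a colouring on whose classes the form is bounded by \<open>\<epsilon> ^ k\<close>, the block diagonal part \<open>g\<close>
  of \<open>h\<close> has norm at most \<open>\<epsilon> ^ k\<close> as a whole, because the classes are orthogonal. So \<open>g / \<epsilon> ^ k\<close>
  and its negative are again contractions with zero diagonal. Paving both and taking the common
  refinement gains a factor \<open>\<epsilon>\<close> in absolute value at the price of a factor \<open>r * r\<close> in the number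
  of colours.\<close>
lemma iterate_paving:
  assumes P: "one_sided_paving \<epsilon> r" and \<epsilon>: "0 < \<epsilon>"
    and h: "hermitian n h" "\<forall>i<n. h i i = 0" "\<forall>x. \<bar>qform n h x\<bar> \<le> sqnorm n x"
  shows "\<exists>c. (\<forall>i<n. c i < (r * r) ^ k) \<and>
    (\<forall>x. monochromatic n c x \<longrightarrow> \<bar>qform n h x\<bar> \<le> \<epsilon> ^ k * sqnorm n x)"
proof (induction k)
  case 0
  show ?case using h(3) by (intro exI[of _ "\<lambda>_. 0"]) auto
next
  case (Suc k)
  then obtain c where c: "\<And>i. i < n \<Longrightarrow> c i < (r * r) ^ k"
    and q: "\<And>x. monochromatic n c x \<Longrightarrow> \<bar>qform n h x\<bar> \<le> \<epsilon> ^ k * sqnorm n x" by blast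
  have ek: "0 < \<epsilon> ^ k" using \<epsilon> by simp
  define g where "g i j = (if c i = c j then h i j else 0)" for i j
  define g1 where "g1 s i j = complex_of_real (s / \<epsilon> ^ k) * g i j" for s i j
  have g: "\<bar>qform n g x\<bar> \<le> \<epsilon> ^ k * sqnorm n x" for x
  proof -
    have "qform n g x = (\<Sum>t<(r * r) ^ k. qform n h (\<lambda>i. if c i = t then x i else 0))"
      unfolding g_def by (rule colour_classes_sum(1)) (rule c)
    hence "\<bar>qform n g x\<bar> \<le> (\<Sum>t<(r * r) ^ k. \<bar>qform n h (\<lambda>i. if c i = t then x i else 0)\<bar>)"
      by (simp only: sum_abs)
    also have "\<dots> \<le> (\<Sum>t<(r * r) ^ k. \<epsilon> ^ k * sqnorm n (\<lambda>i. if c i = t then x i else 0))"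
      by (intro sum_mono q) (auto simp: monochromatic_def)
    also have "\<dots> = \<epsilon> ^ k * sqnorm n x"
      by (simp only: colour_classes_sum(2)[of n c _ x, OF c] sum_distrib_left)
    finally show ?thesis .
  qed
  have q1: "qform n (g1 s) x = s * qform n g x / \<epsilon> ^ k" for s x
    unfolding g1_def by (simp only: qform_scale) simp
  have col: "\<exists>a. (\<forall>i<n. a i < r) \<and>
      (\<forall>x. monochromatic n a x \<longrightarrow> - \<epsilon> * sqnorm n x \<le> qform n (g1 s) x)" if s: "\<bar>s\<bar> = 1" for s
  proof -
    have "hermitian n (g1 s)"
      unfolding hermitian_def
    proof (intro allI impI)
      fix i j assume "i < n" "j < n"
      hence "h j i = cnj (h i j)" using h(1) unfolding hermitian_def by blast
      thus "g1 s j i = cnj (g1 s i j)"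
        by (cases "c i = c j") (simp_all add: g1_def g_def)
    qed
    moreover have "\<forall>i<n. g1 s i i = 0" using h(2) by (simp add: g1_def g_def)
    moreover have "\<forall>x. \<bar>qform n (g1 s) x\<bar> \<le> sqnorm n x"
      using g ek by (simp add: q1 abs_mult s field_simps)
    ultimately show ?thesis using P unfolding one_sided_paving_def by blast
  qed
  obtain a where a: "\<And>i. i < n \<Longrightarrow> a i < r"
      "\<And>x. monochromatic n a x \<Longrightarrow> - \<epsilon> * sqnorm n x \<le> qform n (g1 1) x"
    using col[of 1] by auto
  obtain b where b: "\<And>i. i < n \<Longrightarrow> b i < r"
      "\<And>x. monochromatic n b x \<Longrightarrow> - \<epsilon> * sqnorm n x \<le> qform n (g1 (-1)) x"
    using col[of "-1"] by auto
  define e where "e i = (a i * r + b i) * (r * r) ^ k + c i" for i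
  have lt: "u * m + v < p * m" if "u < p" "v < m" for u v m p :: nat
    using mult_le_mono1[of "Suc u" p m] that by simp
  have "e i < (r * r) ^ Suc k" if "i < n" for i
    unfolding e_def power_Suc using that by (intro lt a b c)
  moreover have "\<bar>qform n h x\<bar> \<le> \<epsilon> ^ Suc k * sqnorm n x" if "monochromatic n e x" for x
  proof -
    obtain t where t: "\<And>i. i < n \<Longrightarrow> e i \<noteq> t \<Longrightarrow> x i = 0"
      using \<open>monochromatic n e x\<close> by (rule monochromatic_const) blast
    have dec: "c i = e i mod (r * r) ^ k" "b i = e i div (r * r) ^ k mod r"
      "a i = e i div (r * r) ^ k div r" if "i < n" for i
      using a(1)[OF that] b(1)[OF that] c[OF that] by (auto simp: e_def)
    have "monochromatic n c x" "monochromatic n b x" "monochromatic n a x"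
      unfolding monochromatic_def using t dec by metis+
    note m = this
    have "qform n g x = qform n h x" unfolding g_def by (rule qform_mask[OF m(1)])
    hence "- \<epsilon> * sqnorm n x \<le> qform n h x / \<epsilon> ^ k" "- \<epsilon> * sqnorm n x \<le> - qform n h x / \<epsilon> ^ k"
      using a(2)[OF m(3)] b(2)[OF m(2)] by (simp_all add: q1)
    thus ?thesis using ek by (simp add: field_simps abs_le_iff)
  qed
  ultimately show ?case by blast
qed

section \<open>Dilating a contraction to a tight frame\<close>

text \<open>Write \<open>h = U d U\<^sup>*\<close> with \<open>\<bar>d\<bar> \<le> 1\<close>. The rows of \<open>U (1 + d)\<^sup>1\<^sup>/\<^sup>2\<close> together with those of
  \<open>U (1 - d)\<^sup>1\<^sup>/\<^sup>2\<close> have unit norm because \<open>h\<close> has zero diagonal, and they form a 2-tight frame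
  because \<open>(1 + d) + (1 - d) = 2\<close>. The Gram matrix of the first half is \<open>1 + h\<close>, so a lower Riesz
  bound \<open>\<delta>\<close> on a colour class is the lower bound \<open>- (1 - \<delta>)\<close> for \<open>h\<close>.\<close>
lemma frames_imp_one_sided_paving:
  assumes frames: "\<And>n F. tight2 n (2 * n) F \<Longrightarrow> Riesz_colourable n (2 * n) F \<delta> r"
  shows "one_sided_paving (1 - \<delta>) r"
  unfolding one_sided_paving_def
proof (intro allI impI)
  fix n h
  assume h: "hermitian n h" and diag: "\<forall>i<n. h i i = 0"
    and contr: "\<forall>x. \<bar>qform n h x\<bar> \<le> sqnorm n x"
  obtain U d where U: "unitary n U"
    and hU: "\<And>i j. i < n \<Longrightarrow> j < n \<Longrightarrow> h i j = (\<Sum>m<n. of_real (d m) * U i m * cnj (U j m))"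
    using spectral_decomposition[OF h] by blast
  have rows: "orthonormal_rows n n U" and cols: "orthonormal_rows n n (\<lambda>i j. U j i)"
    using U by (auto simp: unitary_def)
  have q: "qform n h x = (\<Sum>m<n. d m * (cmod (\<Sum>i<n. x i * U i m))\<^sup>2)" for x
    by (rule qform_diagonalized) (rule hU)
  have d1: "\<bar>d l\<bar> \<le> 1" if l: "l < n" for l
  proof -
    \<comment> \<open>the form takes the value \<open>d l\<close> at this unit vector\<close>
    define u where "u i = cnj (U i l)" for i
    have uU: "(\<Sum>i<n. u i * U i m) = of_bool (m = l)" if "m < n" for m
      using cols l that unfolding orthonormal_rows_def u_def by (simp only: mult.commute)
    have "qform n h u = (\<Sum>m<n. d m * of_bool (m = l))"
      unfolding q by (intro sum.cong refl) (simp add: uU)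
    also have "\<dots> = d l" using l by (simp add: of_bool_def if_distrib cong: if_cong)
    finally have "qform n h u = d l" .
    moreover have "sqnorm n u = 1"
      using uU[OF l] of_real_sqnorm[of n u] by (simp add: u_def)
    ultimately show ?thesis using contr by metis
  qed
  have dp: "0 \<le> 1 + d l" "0 \<le> 1 - d l" if "l < n" for l
    using d1[OF that] by linarith+
  define F where "F i k = (if i < n then of_real (sqrt (1 + d k)) * U i k
      else of_real (sqrt (1 - d k)) * U (i - n) k)" for i k
  have split: "(\<Sum>i<2 * n. f i) = (\<Sum>i<n. f i) + (\<Sum>i<n. f (n + i))" for f :: "nat \<Rightarrow> real"
    using sum.nat_group[of f n 2] sum.shift_bounds_nat_ivl[of f 0 n n]
    by (simp add: numeral_2_eq_2 atLeast0LessThan mult.commute add.commute)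
  have diagU: "(\<Sum>k<n. d k * (cmod (U i k))\<^sup>2) = 0" and normU: "(\<Sum>k<n. (cmod (U i k))\<^sup>2) = 1"
    if "i < n" for i
  proof -
    have "complex_of_real (\<Sum>k<n. d k * (cmod (U i k))\<^sup>2) = h i i"
      using hU[OF that that] by (simp only: of_real_sum of_real_mult complex_norm_square mult.assoc)
    also have "\<dots> = of_real 0" using diag that by simp
    finally show "(\<Sum>k<n. d k * (cmod (U i k))\<^sup>2) = 0" by (simp only: of_real_eq_iff)
    have "complex_of_real (\<Sum>k<n. (cmod (U i k))\<^sup>2) = 1"
      using rows that by (simp only: of_real_sum complex_norm_square orthonormal_rows_def) simp
    thus "(\<Sum>k<n. (cmod (U i k))\<^sup>2) = 1" by (simp only: of_real_eq_1_iff)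
  qed
  have unit: "sqnorm n (F i) = 1" if "i < 2 * n" for i
  proof (cases "i < n")
    case True
    have "sqnorm n (F i) = (\<Sum>k<n. (1 + d k) * (cmod (U i k))\<^sup>2)"
      unfolding sqnorm_def using dp True
      by (intro sum.cong refl) (auto simp: F_def norm_mult power_mult_distrib)
    thus ?thesis using diagU[OF True] normU[OF True] by (simp add: distrib_right sum.distrib)
  next
    case False
    hence i: "i - n < n" using that by simp
    have "sqnorm n (F i) = (\<Sum>k<n. (1 - d k) * (cmod (U (i - n) k))\<^sup>2)"
      unfolding sqnorm_def using dp False
      by (intro sum.cong refl) (auto simp: F_def norm_mult power_mult_distrib)
    thus ?thesis using diagU[OF i] normU[OF i] by (simp add: left_diff_distrib sum_subtractf)
  qed
  have tight: "(\<Sum>i<2 * n. (cmod (\<Sum>k<n. x k * cnj (F i k)))\<^sup>2) = 2 * sqnorm n x" for x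
  proof -
    have P: "(\<Sum>i<n. (cmod (\<Sum>k<n. y k * cnj (U i k)))\<^sup>2) = sqnorm n y" for y
      by (rule parseval[OF orthonormal_rows_cnj[OF cols]])
    have "(\<Sum>i<n. (cmod (\<Sum>k<n. x k * cnj (F i k)))\<^sup>2) = sqnorm n (\<lambda>k. x k * of_real (sqrt (1 + d k)))"
      unfolding P[symmetric] by (intro sum.cong refl) (simp add: F_def mult.assoc)
    moreover have "(\<Sum>i<n. (cmod (\<Sum>k<n. x k * cnj (F (n + i) k)))\<^sup>2)
        = sqnorm n (\<lambda>k. x k * of_real (sqrt (1 - d k)))"
      unfolding P[symmetric] by (intro sum.cong refl) (simp add: F_def mult.assoc)
    moreover have "sqnorm n (\<lambda>k. x k * of_real (sqrt (1 + d k)))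
        + sqnorm n (\<lambda>k. x k * of_real (sqrt (1 - d k))) = 2 * sqnorm n x"
      unfolding sqnorm_def sum.distrib[symmetric] sum_distrib_left using dp
      by (intro sum.cong refl) (auto simp: norm_mult power_mult_distrib algebra_simps)
    ultimately show ?thesis by (simp add: split)
  qed
  have "tight2 n (2 * n) F" using unit tight by (simp add: tight2_def)
  then obtain c where c: "\<forall>i<2 * n. c i < r"
    and R: "\<And>x. monochromatic (2 * n) c x \<Longrightarrow> \<delta> * sqnorm (2 * n) x \<le> energy n (2 * n) F x"
    using frames unfolding Riesz_colourable_def by blast
  have "- (1 - \<delta>) * sqnorm n x \<le> qform n h x" if mono: "monochromatic n c x" for x
  proof -
    define y where "y i = (if i < n then x i else 0)" for i
    have "monochromatic (2 * n) c y"
      using mono unfolding monochromatic_def y_def by (metis (full_types))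
    moreover have "sqnorm (2 * n) y = sqnorm n x"
      by (simp add: sqnorm_def split y_def)
    moreover have "energy n (2 * n) F y = sqnorm n x + qform n h x"
    proof -
      have "(\<Sum>i<2 * n. y i * F i k) = of_real (sqrt (1 + d k)) * (\<Sum>i<n. x i * U i k)" for k
      proof -
        have "(\<Sum>i<2 * n. y i * F i k) = (\<Sum>i<n. y i * F i k)"
          by (rule sum.mono_neutral_right) (auto simp: y_def)
        thus ?thesis by (simp add: y_def F_def sum_distrib_left mult_ac)
      qed
      hence "energy n (2 * n) F y = (\<Sum>k<n. (1 + d k) * (cmod (\<Sum>i<n. x i * U i k))\<^sup>2)"
        unfolding energy_def using dp
        by (intro sum.cong refl) (auto simp: norm_mult power_mult_distrib)
      thus ?thesis
        by (simp only: distrib_right sum.distrib mult_1 q parseval[OF rows])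
    qed
    ultimately show ?thesis using R[of y] by (simp add: algebra_simps)
  qed
  thus "\<exists>c. (\<forall>i<n. c i < r) \<and>
      (\<forall>x. monochromatic n c x \<longrightarrow> - (1 - \<delta>) * sqnorm n x \<le> qform n h x)"
    using c by (intro exI[of _ c]) auto
qed

section \<open>Flattening a frame with the discrete Fourier matrix\<close>

lemma sum_div_mod:
  fixes f :: "nat \<Rightarrow> nat \<Rightarrow> 'a::comm_monoid_add"
  shows "(\<Sum>j<n * K. f (j div K) (j mod K)) = (\<Sum>a<n. \<Sum>b<K. f a b)"
proof (cases "K = 0")
  case False
  have "(\<Sum>j<n * K. f (j div K) (j mod K)) = (\<Sum>a<n. \<Sum>j\<in>{a * K..<a * K + K}. f (j div K) (j mod K))"
    by (rule sum.nat_group[symmetric])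
  also have "\<dots> = (\<Sum>a<n. \<Sum>b<K. f a b)"
  proof (rule sum.cong[OF refl])
    fix a
    have "(\<Sum>j\<in>{0 + a * K..<K + a * K}. f (j div K) (j mod K))
        = (\<Sum>b\<in>{0..<K}. f ((b + a * K) div K) ((b + a * K) mod K))"
      by (rule sum.shift_bounds_nat_ivl)
    also have "\<dots> = (\<Sum>b<K. f a b)"
      unfolding atLeast0LessThan using False by (intro sum.cong refl) simp
    finally show "(\<Sum>j\<in>{a * K..<a * K + K}. f (j div K) (j mod K)) = (\<Sum>b<K. f a b)"
      by (simp add: add.commute)
  qed
  finally show ?thesis .
qed simp

definition dft :: "nat \<Rightarrow> nat \<Rightarrow> nat \<Rightarrow> complex" where
  "dft K k l = cis (2 * pi * real k * real l / real K) / of_real (sqrt (real K))"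

lemma cmod_dft: "cmod (dft K k l) = 1 / sqrt (real K)"
  by (simp add: dft_def norm_divide)

text \<open>The inner product of two rows is a geometric sum over a nontrivial root of unity, unless the rows
  coincide.\<close>
lemma unitary_dft:
  assumes K: "0 < K"
  shows "unitary K (dft K)"
proof -
  have "(\<Sum>t<K. dft K k t * cnj (dft K l t)) = of_bool (k = l)" if kl: "k < K" "l < K" for k l
  proof -
    define z where "z = cis (2 * pi * (real k - real l) / real K)"
    have "(\<Sum>t<K. dft K k t * cnj (dft K l t)) = (\<Sum>t<K. z ^ t / of_real (real K))"
    proof (intro sum.cong refl)
      fix t
      have "z ^ t = cis (2 * pi * real k * real t / real K) * cis (- (2 * pi * real l * real t / real K))"
        unfolding z_def Complex.DeMoivre cis_mult using K
        by (intro arg_cong[of _ _ cis]) (simp add: field_simps)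
      moreover have "complex_of_real (sqrt (real K)) * complex_of_real (sqrt (real K)) = of_real (real K)"
        by (simp flip: of_real_mult)
      ultimately show "dft K k t * cnj (dft K l t) = z ^ t / of_real (real K)"
        by (simp add: dft_def cis_cnj)
    qed
    also have "\<dots> = (\<Sum>t<K. z ^ t) / of_nat K"
      by (simp add: sum_divide_distrib)
    also have "\<dots> = of_bool (k = l)"
    proof (cases "k = l")
      case True
      thus ?thesis using K by (simp add: z_def)
    next
      case False
      have zK: "z ^ K = 1"
      proof -
        have "real K * (2 * pi * (real k - real l) / real K) = 2 * pi * of_int (int k - int l)"
          using K by simp
        thus ?thesis unfolding z_def Complex.DeMoivre
          by (simp only: cis_multiple_2pi Ints_of_int)
      qed
      have "z \<noteq> 1"
      proof
        assume "z = 1"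
        hence "cos (2 * pi * (real k - real l) / real K) = 1" by (simp add: z_def complex_eq_iff)
        then obtain m :: int where "2 * pi * (real k - real l) / real K = of_int m * 2 * pi"
          by (auto simp: cos_one_2pi_int)
        hence "2 * pi * (real k - real l) = 2 * pi * (of_int m * real K)"
          using K by (simp add: field_simps)
        hence "real k - real l = of_int m * real K" by simp
        hence "of_int (int k - int l) = (of_int (m * int K) :: real)" by simp
        hence "int k - int l = m * int K" by (simp only: of_int_eq_iff)
        hence "int K dvd int k - int l" by simp
        hence "int K \<le> \<bar>int k - int l\<bar>" using False by (intro zdvd_imp_le) auto
        thus False using kl by linarith
      qed
      thus ?thesis using zK False by (simp add: geometric_sum)
    qed
    finally show ?thesis .
  qed
  moreover have "dft K k l = dft K l k" for k l by (simp add: dft_def mult_ac)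
  ultimately show ?thesis unfolding unitary_def orthonormal_rows_def by simp
qed

text \<open>The Kronecker product \<open>F \<otimes> D\<close>, with the pair \<open>(a, b)\<close> coded as \<open>a * K + b\<close>.\<close>
definition tensor :: "nat \<Rightarrow> (nat \<Rightarrow> nat \<Rightarrow> complex) \<Rightarrow> (nat \<Rightarrow> nat \<Rightarrow> complex) \<Rightarrow> nat \<Rightarrow> nat \<Rightarrow> complex" where
  "tensor K F D i j = F (i div K) (j div K) * D (i mod K) (j mod K)"

lemma tight2_tensor:
  assumes F: "tight2 N M F" and D: "unitary K D"
  shows "tight2 (N * K) (M * K) (tensor K F D)"
  unfolding tight2_def
proof (intro conjI allI impI)
  have rows: "orthonormal_rows K K D" and cols: "orthonormal_rows K K (\<lambda>i j. D j i)"
    using D by (auto simp: unitary_def)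
  have normD: "sqnorm K (D k) = 1" if "k < K" for k
  proof -
    have "complex_of_real (sqnorm K (D k)) = 1"
      using rows that unfolding of_real_sqnorm orthonormal_rows_def by simp
    thus ?thesis by (simp only: of_real_eq_1_iff)
  qed
  fix i assume i: "i < M * K"
  hence "i div K < M" "i mod K < K" by (auto simp: less_mult_imp_div_less intro!: mod_less_divisor gr0I)
  moreover have "sqnorm (N * K) (tensor K F D i) = sqnorm N (F (i div K)) * sqnorm K (D (i mod K))"
    unfolding sqnorm_def tensor_def
    using sum_div_mod[of "\<lambda>a b. (cmod (F (i div K) a * D (i mod K) b))\<^sup>2" K N]
    by (simp add: norm_mult power_mult_distrib sum_product)
  ultimately show "sqnorm (N * K) (tensor K F D i) = 1"
    using F normD by (simp add: tight2_def)
next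
  have cols: "orthonormal_rows K K (\<lambda>i j. D j i)"
    using D by (auto simp: unitary_def)
  fix x
  let ?y = "\<lambda>i b. \<Sum>a<N. x (a * K + b) * cnj (F i a)"
  have inner: "(\<Sum>j<N * K. x j * cnj (tensor K F D i j)) = (\<Sum>b<K. ?y (i div K) b * cnj (D (i mod K) b))" for i
  proof -
    have "(\<Sum>j<N * K. x j * cnj (tensor K F D i j))
        = (\<Sum>a<N. \<Sum>b<K. x (a * K + b) * cnj (F (i div K) a * D (i mod K) b))"
      using sum_div_mod[of "\<lambda>a b. x (a * K + b) * cnj (F (i div K) a * D (i mod K) b)" K N]
      by (simp add: tensor_def)
    also have "\<dots> = (\<Sum>b<K. ?y (i div K) b * cnj (D (i mod K) b))"
      by (subst sum.swap) (simp add: sum_distrib_right mult.assoc)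
    finally show ?thesis .
  qed
  have "(\<Sum>i<M * K. (cmod (\<Sum>j<N * K. x j * cnj (tensor K F D i j)))\<^sup>2)
      = (\<Sum>i<M. \<Sum>k<K. (cmod (\<Sum>b<K. ?y i b * cnj (D k b)))\<^sup>2)"
    unfolding inner
    using sum_div_mod[of "\<lambda>i k. (cmod (\<Sum>b<K. ?y i b * cnj (D k b)))\<^sup>2" K M] .
  also have "\<dots> = (\<Sum>i<M. \<Sum>b<K. (cmod (?y i b))\<^sup>2)"
    using parseval[OF orthonormal_rows_cnj[OF cols]] by (simp add: sqnorm_def)
  also have "\<dots> = (\<Sum>b<K. \<Sum>i<M. (cmod (?y i b))\<^sup>2)" by (rule sum.swap)
  also have "\<dots> = (\<Sum>b<K. 2 * sqnorm N (\<lambda>a. x (a * K + b)))"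
    using F by (simp add: tight2_def)
  also have "\<dots> = 2 * (\<Sum>a<N. \<Sum>b<K. (cmod (x (a * K + b)))\<^sup>2)"
    unfolding sqnorm_def sum_distrib_left[symmetric] by (subst sum.swap) simp
  also have "\<dots> = 2 * sqnorm (N * K) x"
    using sum_div_mod[of "\<lambda>a b. (cmod (x (a * K + b)))\<^sup>2" K N] by (simp add: sqnorm_def)
  finally show "(\<Sum>i<M * K. (cmod (\<Sum>j<N * K. x j * cnj (tensor K F D i j)))\<^sup>2) = 2 * sqnorm (N * K) x" .
qed

text \<open>The vectors of \<open>F \<otimes> D\<close> with index \<open>(i, 0)\<close> are \<open>F i\<close> tensored with one fixed unit vector, hence an
  isometric copy of the family \<open>F\<close>.\<close>
lemma Riesz_colourable_of_tensor:
  assumes K: "0 < K" and D: "sqnorm K (D 0) = 1"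
    and R: "Riesz_colourable (N * K) (M * K) (tensor K F D) \<delta> r"
  shows "Riesz_colourable N M F \<delta> r"
proof -
  obtain c where c: "\<And>i. i < M * K \<Longrightarrow> c i < r"
    and cR: "\<And>x. monochromatic (M * K) c x \<Longrightarrow>
      \<delta> * sqnorm (M * K) x \<le> energy (N * K) (M * K) (tensor K F D) x"
    using R unfolding Riesz_colourable_def by blast
  have "\<delta> * sqnorm M x \<le> energy N M F x" if mono: "monochromatic M (\<lambda>i. c (i * K)) x" for x
  proof -
    define y where "y i = (if i mod K = 0 then x (i div K) else 0)" for i
    obtain t where t: "\<And>i. i < M \<Longrightarrow> c (i * K) \<noteq> t \<Longrightarrow> x i = 0"
      using mono by (rule monochromatic_const) blast
    have "y i = 0" if "i < M * K" "c i \<noteq> t" for i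
    proof (cases "i mod K = 0")
      case True
      hence "i div K * K = i" by auto
      thus ?thesis using t[of "i div K"] that less_mult_imp_div_less[OF that(1)] by (simp add: y_def)
    qed (simp add: y_def)
    hence "monochromatic (M * K) c y" by (auto simp: monochromatic_def)
    moreover have "sqnorm (M * K) y = sqnorm M x"
    proof -
      have "(cmod (y i))\<^sup>2 = (if i mod K = 0 then (cmod (x (i div K)))\<^sup>2 else 0)" for i
        by (simp add: y_def)
      hence "sqnorm (M * K) y = (\<Sum>a<M. \<Sum>b<K. if b = 0 then (cmod (x a))\<^sup>2 else 0)"
        unfolding sqnorm_def
        using sum_div_mod[of "\<lambda>a b. if b = 0 then (cmod (x a))\<^sup>2 else 0" K M]
        by (simp only:)
      thus ?thesis using K by (simp add: sqnorm_def)
    qed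
    moreover have "energy (N * K) (M * K) (tensor K F D) y = energy N M F x"
    proof -
      have "(\<Sum>i<M * K. y i * tensor K F D i j) = (\<Sum>i<M. x i * F i (j div K)) * D 0 (j mod K)" for j
      proof -
        have "(\<Sum>i<M * K. y i * tensor K F D i j)
            = (\<Sum>a<M. \<Sum>b<K. if b = 0 then x a * F a (j div K) * D b (j mod K) else 0)"
          using sum_div_mod[of "\<lambda>a b. if b = 0 then x a * F a (j div K) * D b (j mod K) else 0" K M]
          by (simp add: tensor_def y_def if_distrib if_distribR mult.assoc cong: if_cong)
        thus ?thesis using K by (simp add: sum_distrib_right)
      qed
      hence "energy (N * K) (M * K) (tensor K F D) y
          = (\<Sum>j<N * K. (cmod (\<Sum>i<M. x i * F i (j div K)))\<^sup>2 * (cmod (D 0 (j mod K)))\<^sup>2)"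
        by (simp add: energy_def norm_mult power_mult_distrib)
      also have "\<dots> = (\<Sum>a<N. (cmod (\<Sum>i<M. x i * F i a))\<^sup>2 * sqnorm K (D 0))"
        using sum_div_mod[of "\<lambda>a b. (cmod (\<Sum>i<M. x i * F i a))\<^sup>2 * (cmod (D 0 b))\<^sup>2" K N]
        by (simp add: sqnorm_def sum_distrib_left)
      finally show ?thesis by (simp add: D energy_def)
    qed
    ultimately show ?thesis using cR[of y] by simp
  qed
  moreover have "c (i * K) < r" if "i < M" for i using that K by (intro c) simp
  ultimately show ?thesis
    unfolding Riesz_colourable_def by (intro exI[of _ "\<lambda>i. c (i * K)"]) blast
qed

section \<open>Energy bounds\<close>

lemma cauchy_schwarz:
  "(cmod (\<Sum>i<n. a i * b i))\<^sup>2 \<le> sqnorm n a * sqnorm n b"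
proof -
  have "cmod (\<Sum>i<n. a i * b i) \<le> (\<Sum>i<n. \<bar>cmod (a i)\<bar> * \<bar>cmod (b i)\<bar>)"
    by (rule order_trans[OF norm_sum]) (simp add: norm_mult)
  also have "\<dots> \<le> L2_set (\<lambda>i. cmod (a i)) {..<n} * L2_set (\<lambda>i. cmod (b i)) {..<n}"
    by (rule L2_set_mult_ineq)
  also have "\<dots> = sqrt (sqnorm n a * sqnorm n b)"
    by (simp add: L2_set_def sqnorm_def real_sqrt_mult)
  finally have "(cmod (\<Sum>i<n. a i * b i))\<^sup>2 \<le> (sqrt (sqnorm n a * sqnorm n b))\<^sup>2"
    by (rule power_mono) simp
  thus ?thesis by simp
qed

text \<open>A crude bound that shows the synthesis map of any finite family to be bounded; it makes the supremum
  in the operator norm finite.\<close>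
lemma energy_le_sum_sqnorm: "energy N M F x \<le> sqnorm M x * (\<Sum>i<M. sqnorm N (F i))"
proof -
  have "energy N M F x \<le> (\<Sum>k<N. sqnorm M x * sqnorm M (\<lambda>i. F i k))"
    unfolding energy_def by (intro sum_mono cauchy_schwarz)
  also have "\<dots> = sqnorm M x * (\<Sum>i<M. sqnorm N (F i))"
    unfolding sum_distrib_left[symmetric] by (simp add: sqnorm_def sum.swap[of _ "{..<N}"])
  finally show ?thesis .
qed

text \<open>The synthesis operator is the adjoint of the analysis operator, whose norm is \<open>\<surd>2\<close>. Concretely, the
  energy \<open>E\<close> is the pairing of \<open>x\<close> with the frame coefficients of the synthesised vector, whose squared
  norm is \<open>2 E\<close>, so the Cauchy-Schwarz inequality gives \<open>E\<^sup>2 \<le> 2 E sqnorm x\<close>.\<close>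
lemma tight2_energy_le:
  assumes "tight2 N M F"
  shows "energy N M F x \<le> 2 * sqnorm M x"
proof -
  define y where "y k = (\<Sum>i<M. x i * F i k)" for k
  define g where "g i = (\<Sum>k<N. F i k * cnj (y k))" for i
  let ?E = "energy N M F x"
  have E: "?E = sqnorm N y" by (simp add: energy_def sqnorm_def y_def)
  have "cmod (g i) = cmod (\<Sum>k<N. y k * cnj (F i k))" for i
  proof -
    have "g i = cnj (\<Sum>k<N. y k * cnj (F i k))"
      by (simp only: g_def cnj_sum complex_cnj_mult complex_cnj_cnj mult.commute)
    thus ?thesis by (simp only: complex_mod_cnj)
  qed
  hence "sqnorm M g = 2 * ?E"
    using assms unfolding E sqnorm_def[of M] tight2_def by simp
  moreover have "complex_of_real ?E = (\<Sum>i<M. x i * g i)"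
  proof -
    have "complex_of_real ?E = (\<Sum>k<N. \<Sum>i<M. x i * (F i k * cnj (y k)))"
      unfolding E of_real_sqnorm
      by (intro sum.cong refl) (subst (1) y_def, simp only: sum_distrib_right mult.assoc)
    thus ?thesis by (subst (asm) sum.swap) (simp only: g_def sum_distrib_left)
  qed
  hence "?E\<^sup>2 = (cmod (\<Sum>i<M. x i * g i))\<^sup>2" by (metis norm_of_real power2_abs)
  ultimately have "?E * ?E \<le> (2 * sqnorm M x) * ?E"
    using cauchy_schwarz[of x g M] by (simp add: power2_eq_square mult_ac)
  thus ?thesis
  proof (cases "?E = 0")
    case False
    hence "0 < ?E" using E sqnorm_nonneg[of N y] by linarith
    thus ?thesis using \<open>?E * ?E \<le> (2 * sqnorm M x) * ?E\<close> by (simp only: mult_le_cancel_right_pos)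
  qed simp
qed

section \<open>Vectors and operators in coordinates\<close>

lemma hnorm_sq:
  assumes "v \<in> carrier_vec N"
  shows "(hnorm v)\<^sup>2 = sqnorm N (($) v)"
proof -
  have "v \<bullet>c v = of_real (sqnorm N (($) v))"
    using assms by (simp add: scalar_prod_def of_real_sqnorm atLeast0LessThan)
  thus ?thesis by (simp add: hnorm_def)
qed

lemma hnorm_nonneg: "v \<in> carrier_vec n \<Longrightarrow> 0 \<le> hnorm v"
  by (simp add: hnorm_def scalar_prod_def sum_nonneg)

lemma hnorm_eq_1_iff:
  assumes "v \<in> carrier_vec N"
  shows "hnorm v = 1 \<longleftrightarrow> sqnorm N (($) v) = 1"
proof -
  have "hnorm v = 1 \<longleftrightarrow> (hnorm v)\<^sup>2 = 1" using hnorm_nonneg[OF assms] by (metis abs_of_nonneg abs_square_eq_1)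
  thus ?thesis by (simp add: hnorm_sq[OF assms])
qed

lemma sqnorm_cong: "(\<And>i. i < n \<Longrightarrow> x i = y i) \<Longrightarrow> sqnorm n x = sqnorm n y"
  by (simp add: sqnorm_def)

lemma tight2_iff:
  assumes f: "\<And>i. i < M \<Longrightarrow> f i \<in> carrier_vec N"
  shows "unit_norm_2_tight_frame N M f \<longleftrightarrow> tight2 N M (\<lambda>i k. f i $ k)"
proof -
  have ip: "x \<bullet>c f i = (\<Sum>k<N. x $ k * cnj (f i $ k))" if "x \<in> carrier_vec N" "i < M" for x i
    using that f[of i] by (simp add: scalar_prod_def atLeast0LessThan)
  have "(\<forall>x\<in>carrier_vec N. (\<Sum>i<M. (cmod (x \<bullet>c f i))\<^sup>2) = 2 * (hnorm x)\<^sup>2)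
      \<longleftrightarrow> (\<forall>x. (\<Sum>i<M. (cmod (\<Sum>k<N. x k * cnj (f i $ k)))\<^sup>2) = 2 * sqnorm N x)" (is "?L \<longleftrightarrow> ?R")
  proof
    assume L: ?L
    show ?R
    proof
      fix x
      have "(\<Sum>i<M. (cmod (vec N x \<bullet>c f i))\<^sup>2) = 2 * (hnorm (vec N x))\<^sup>2" using L by simp
      thus "(\<Sum>i<M. (cmod (\<Sum>k<N. x k * cnj (f i $ k)))\<^sup>2) = 2 * sqnorm N x"
        by (simp add: ip hnorm_sq[of _ N] cong: sqnorm_cong)
    qed
  next
    assume ?R
    thus ?L by (simp add: ip hnorm_sq[of _ N])
  qed
  thus ?thesis using f unfolding unit_norm_2_tight_frame_def tight2_def
    by (auto simp: hnorm_eq_1_iff[of _ N])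
qed

lemma hnorm_finsum_sq:
  assumes f: "\<And>i. i < M \<Longrightarrow> f i \<in> carrier_vec N" and S: "S \<subseteq> {..<M}"
  shows "(hnorm (finsum_vec TYPE(complex) N (\<lambda>i. a i \<cdot>\<^sub>v f i) S))\<^sup>2
    = energy N M (\<lambda>i k. f i $ k) (\<lambda>i. if i \<in> S then a i else 0)"
proof -
  have fin: "finite S" using S finite_subset by blast
  have car: "(\<lambda>i. a i \<cdot>\<^sub>v f i) \<in> S \<rightarrow> carrier_vec N" using f S by auto
  have "finsum_vec TYPE(complex) N (\<lambda>i. a i \<cdot>\<^sub>v f i) S $ k
      = (\<Sum>i<M. (if i \<in> S then a i else 0) * f i $ k)" if "k < N" for k
  proof -
    have "finsum_vec TYPE(complex) N (\<lambda>i. a i \<cdot>\<^sub>v f i) S $ k = (\<Sum>i\<in>S. (a i \<cdot>\<^sub>v f i) $ k)"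
      by (rule index_finsum_vec[OF fin that car])
    also have "\<dots> = (\<Sum>i\<in>S. (if i \<in> S then a i else 0) * f i $ k)"
    proof (rule sum.cong[OF refl])
      fix i assume "i \<in> S"
      hence "dim_vec (f i) = N" using f S by auto
      thus "(a i \<cdot>\<^sub>v f i) $ k = (if i \<in> S then a i else 0) * f i $ k"
        using \<open>i \<in> S\<close> that by simp
    qed
    also have "\<dots> = (\<Sum>i<M. (if i \<in> S then a i else 0) * f i $ k)"
      using S by (intro sum.mono_neutral_left) auto
    finally show ?thesis .
  qed
  thus ?thesis
    unfolding hnorm_sq[OF finsum_vec_closed[OF car]] by (simp add: energy_def sqnorm_def)
qed

lemma sqnorm_restrict:
  assumes "S \<subseteq> {..<M}"
  shows "sqnorm M (\<lambda>i. if i \<in> S then a i else 0) = (\<Sum>i\<in>S. (cmod (a i))\<^sup>2)"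
proof -
  have "sqnorm M (\<lambda>i. if i \<in> S then a i else 0) = (\<Sum>i\<in>S. (cmod (if i \<in> S then a i else 0))\<^sup>2)"
    unfolding sqnorm_def using assms by (intro sum.mono_neutral_right) auto
  thus ?thesis by simp
qed

lemma energy_cong: "(\<And>i. i < M \<Longrightarrow> x i = y i) \<Longrightarrow> energy N M F x = energy N M F y"
  by (simp add: energy_def)

lemma Rieszable_iff:
  assumes f: "\<And>i. i < M \<Longrightarrow> f i \<in> carrier_vec N"
  shows "Rieszable N M f \<delta> r \<longleftrightarrow> Riesz_colourable N M (\<lambda>i k. f i $ k) \<delta> r"
proof
  assume "Rieszable N M f \<delta> r"
  then obtain P where disj: "disjoint_family_on P {..<r}" and un: "(\<Union>j<r. P j) = {..<M}"
    and P: "\<And>j a. j < r \<Longrightarrow> \<delta> * (\<Sum>i\<in>P j. (cmod (a i))\<^sup>2)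
        \<le> (hnorm (finsum_vec TYPE(complex) N (\<lambda>i. a i \<cdot>\<^sub>v f i) (P j)))\<^sup>2"
    unfolding Rieszable_def by metis
  have "\<exists>j<r. i \<in> P j" if "i < M" for i
    using un that by (metis UN_E lessThan_iff)
  then obtain c where c: "\<And>i. i < M \<Longrightarrow> c i < r \<and> i \<in> P (c i)" by metis
  have "\<delta> * sqnorm M x \<le> energy N M (\<lambda>i k. f i $ k) x" if mono: "monochromatic M c x" for x
  proof -
    obtain t where t: "\<And>i. i < M \<Longrightarrow> c i \<noteq> t \<Longrightarrow> x i = 0"
      using mono by (rule monochromatic_const) blast
    show ?thesis
    proof (cases "t < r")
      case True
      have sub: "P t \<subseteq> {..<M}" using un True by blast
      have x: "x i = (if i \<in> P t then x i else 0)" if "i < M" for i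
        using t[OF that] c[OF that] by auto
      show ?thesis
        using P[OF True, of x] sqnorm_restrict[OF sub, of x] hnorm_finsum_sq[of M f N, OF f sub, of x]
          sqnorm_cong[of M x, OF x] energy_cong[of M x, OF x]
        by simp
    next
      case False
      hence "x i = 0" if "i < M" for i using t[OF that] c[OF that] by auto
      thus ?thesis by (simp add: sqnorm_def energy_def)
    qed
  qed
  thus "Riesz_colourable N M (\<lambda>i k. f i $ k) \<delta> r"
    unfolding Riesz_colourable_def using c by (intro exI[of _ c]) blast
next
  assume "Riesz_colourable N M (\<lambda>i k. f i $ k) \<delta> r"
  then obtain c where c: "\<And>i. i < M \<Longrightarrow> c i < r"
    and R: "\<And>x. monochromatic M c x \<Longrightarrow> \<delta> * sqnorm M x \<le> energy N M (\<lambda>i k. f i $ k) x"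
    unfolding Riesz_colourable_def by blast
  define P where "P j = {i. i < M \<and> c i = j}" for j
  have "disjoint_family_on P {..<r}" by (auto simp: disjoint_family_on_def P_def)
  moreover have "(\<Union>j<r. P j) = {..<M}" using c by (auto simp: P_def)
  moreover have "(hnorm (finsum_vec TYPE(complex) N (\<lambda>i. a i \<cdot>\<^sub>v f i) (P j)))\<^sup>2
      \<ge> \<delta> * (\<Sum>i\<in>P j. (cmod (a i))\<^sup>2)" for j a
  proof -
    have sub: "P j \<subseteq> {..<M}" by (auto simp: P_def)
    have "monochromatic M c (\<lambda>i. if i \<in> P j then a i else 0)"
      by (auto simp: monochromatic_def P_def)
    moreover have "(hnorm (finsum_vec TYPE(complex) N (\<lambda>i. a i \<cdot>\<^sub>v f i) (P j)))\<^sup>2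
        = energy N M (\<lambda>i k. f i $ k) (\<lambda>i. if i \<in> P j then a i else 0)"
      by (intro hnorm_finsum_sq f sub)
    ultimately show ?thesis using R sqnorm_restrict[OF sub, of a] by metis
  qed
  ultimately show "Rieszable N M f \<delta> r"
    unfolding Rieszable_def by (intro exI[of _ P]) blast
qed

lemma linear_operator_iff:
  "linear_operator n T \<longleftrightarrow>
    (\<forall>v\<in>carrier_vec n. T v \<in> carrier_vec n) \<and>
    (\<forall>v\<in>carrier_vec n. \<forall>w\<in>carrier_vec n. T (v + w) = T v + T w) \<and>
    (\<forall>a. \<forall>v\<in>carrier_vec n. T (a \<cdot>\<^sub>v v) = a \<cdot>\<^sub>v T v)"
proof -
  interpret vec_space "TYPE(complex)" n .
  have "linear_operator n T \<longleftrightarrow> mod_hom class_ring V V T"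
    unfolding linear_operator_def linear_map_def
    using vec_vs by auto
  also have "\<dots> \<longleftrightarrow> T \<in> LinearCombinations.module_hom class_ring V V"
    unfolding mod_hom_def mod_hom_axioms_def using vec_module by auto
  finally show ?thesis
    by (auto simp: LinearCombinations.module_hom_def module_vec_simps)
qed

text \<open>Additivity peels off one coordinate at a time, so the induction runs over truncations of \<open>x\<close>.\<close>
lemma linear_operator_coordinates:
  assumes T: "linear_operator n T" and k: "k < n"
  shows "T (vec n x) $ k = (\<Sum>i<n. x i * T (unit_vec n i) $ k)"
proof -
  have car: "T v \<in> carrier_vec n" and smult: "T (a \<cdot>\<^sub>v v) = a \<cdot>\<^sub>v T v"
    if "v \<in> carrier_vec n" for v a
    using T that by (auto simp: linear_operator_iff)
  have add: "T (v + w) = T v + T w" if "v \<in> carrier_vec n" "w \<in> carrier_vec n" for v w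
    using T that by (auto simp: linear_operator_iff)
  have "T (vec n (\<lambda>i. if i < m then x i else 0)) $ k = (\<Sum>i<m. x i * T (unit_vec n i) $ k)"
    if "m \<le> n" for m
    using that
  proof (induction m)
    case 0
    have "vec n (\<lambda>i. if i < 0 then x i else 0) = 0 \<cdot>\<^sub>v 0\<^sub>v n" by (intro eq_vecI) auto
    moreover have "T (0 \<cdot>\<^sub>v 0\<^sub>v n) = 0 \<cdot>\<^sub>v T (0\<^sub>v n)" "T (0\<^sub>v n) \<in> carrier_vec n"
      using smult car by (blast intro: zero_carrier_vec)+
    ultimately show ?case using k by (simp add: carrier_vecD[of "T (0\<^sub>v n)"])
  next
    case (Suc m)
    have "vec n (\<lambda>i. if i < Suc m then x i else 0)
        = vec n (\<lambda>i. if i < m then x i else 0) + x m \<cdot>\<^sub>v unit_vec n m"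
      using Suc.prems by (intro eq_vecI) (auto simp: unit_vec_def less_Suc_eq)
    thus ?case using Suc k car[of "unit_vec n m"] car[of "x m \<cdot>\<^sub>v unit_vec n m"] by (simp add: add smult)
  qed
  moreover have "vec n (\<lambda>i. if i < n then x i else 0) = vec n x" by (intro eq_vecI) auto
  ultimately show ?thesis by (metis order_refl)
qed

lemma hnorm_linear_operator_sq:
  assumes T: "linear_operator n T" and v: "v \<in> carrier_vec n"
  shows "(hnorm (T v))\<^sup>2 = energy n n (\<lambda>i k. T (unit_vec n i) $ k) (($) v)"
proof -
  have v': "vec n (($) v) = v" using v by auto
  have "T v \<in> carrier_vec n" using T v by (simp add: linear_operator_iff)
  from hnorm_sq[OF this] show ?thesis
    using linear_operator_coordinates[OF T, of _ "($) v"] by (simp add: v' sqnorm_def energy_def)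
qed

lemma operator_norm_energy_le:
  assumes T: "linear_operator n T" and B: "operator_norm n T \<le> B" "0 \<le> B"
  shows "energy n n (\<lambda>i k. T (unit_vec n i) $ k) x \<le> B\<^sup>2 * sqnorm n x"
proof (cases "sqnorm n x = 0")
  case True
  have "energy n n (\<lambda>i k. T (unit_vec n i) $ k) x \<le> 0"
    using energy_le_sum_sqnorm[of n n _ x] by (simp add: True)
  thus ?thesis by (simp add: True)
next
  case False
  let ?F = "\<lambda>i k. T (unit_vec n i) $ k"
  let ?S = "{v \<in> carrier_vec n. hnorm v \<le> 1}"
  have bdd: "bdd_above ((\<lambda>v. hnorm (T v)) ` ?S)"
  proof (rule bdd_aboveI2)
    fix v assume v: "v \<in> ?S"
    have "(hnorm v)\<^sup>2 \<le> 1" using v hnorm_nonneg[of v n] by (simp add: power_le_one)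
    hence "(hnorm (T v))\<^sup>2 \<le> 1 * (\<Sum>i<n. sqnorm n (?F i))"
      using v hnorm_linear_operator_sq[OF T, of v] energy_le_sum_sqnorm[of n n ?F "($) v"]
      by (metis (no_types, lifting) hnorm_sq mem_Collect_eq mult_right_mono order_trans sqnorm_nonneg sum_nonneg)
    thus "hnorm (T v) \<le> sqrt (\<Sum>i<n. sqnorm n (?F i))" by (simp add: real_le_rsqrt)
  qed
  define s where "s = sqrt (sqnorm n x)"
  have s: "0 < s" "s\<^sup>2 = sqnorm n x" using False by (auto simp: s_def order_less_le)
  have s_pos: "0 < s\<^sup>2" using s(1) by simp
  define u where "u = vec n (\<lambda>i. of_real (1 / s) * x i)"
  have u: "u \<in> carrier_vec n" by (simp add: u_def)
  have "(hnorm u)\<^sup>2 = sqnorm n (\<lambda>i. of_real (1 / s) * x i)"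
    unfolding hnorm_sq[OF u] by (intro sqnorm_cong) (simp add: u_def)
  also have "\<dots> = 1" unfolding sqnorm_scale s(2)[symmetric] using s(1) by (simp add: norm_divide power_divide)
  finally have "hnorm u = 1" using hnorm_sq[OF u] hnorm_eq_1_iff[OF u] by simp
  hence "hnorm (T u) \<le> operator_norm n T"
    unfolding operator_norm_def using u by (intro cSUP_upper bdd) simp
  hence "hnorm (T u) \<le> B" using B(1) by simp
  moreover have "0 \<le> hnorm (T u)" using T u by (intro hnorm_nonneg[of _ n]) (simp add: linear_operator_iff)
  ultimately have "(hnorm (T u))\<^sup>2 \<le> B\<^sup>2" by (intro power_mono)
  also have "(hnorm (T u))\<^sup>2 = energy n n ?F (\<lambda>i. of_real (1 / s) * x i)"
    unfolding hnorm_linear_operator_sq[OF T u] by (intro energy_cong) (simp add: u_def)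
  also have "\<dots> = energy n n ?F x / s\<^sup>2"
    unfolding energy_def mult.assoc sum_distrib_left[symmetric] sum_divide_distrib
    using s(1) by (simp add: norm_divide norm_mult power_divide)
  finally show ?thesis using s_pos by (simp only: pos_divide_le_eq s(2))
qed

section \<open>The equivalence\<close>

text \<open>The frame vectors are the images of the unit vectors under the synthesis operator, of norm at most
  \<open>\<surd>2 < 2\<close>; padding with zeros makes it an operator on a space of dimension \<open>2 * N\<close>. The constants
  of the conjecture for \<open>B = 2\<close> therefore serve all these frames.\<close>
lemma BT_imp_tight_frames_Rieszable:
  assumes "Bourgain_Tzafriri_Conjecture"
  shows "\<exists>\<delta>>0. \<exists>r. \<forall>N f. unit_norm_2_tight_frame N (2 * N) f \<longrightarrow> Rieszable N (2 * N) f \<delta> r"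
proof -
  obtain A where A: "A > 0" and BT: "\<And>B. B > 1 \<Longrightarrow> \<exists>r. \<forall>n T. linear_operator n T \<and> operator_norm n T \<le> B \<and>
        (\<forall>i<n. hnorm (T (unit_vec n i)) = 1) \<longrightarrow> Rieszable n n (\<lambda>i. T (unit_vec n i)) A r"
    using assms unfolding Bourgain_Tzafriri_Conjecture_def by blast
  obtain r where r: "\<And>n T. linear_operator n T \<Longrightarrow> operator_norm n T \<le> 2 \<Longrightarrow>
        (\<And>i. i < n \<Longrightarrow> hnorm (T (unit_vec n i)) = 1) \<Longrightarrow> Rieszable n n (\<lambda>i. T (unit_vec n i)) A r"
    using BT[of 2] by auto
  have "Rieszable N (2 * N) f A r" if frame: "unit_norm_2_tight_frame N (2 * N) f" for N f
  proof -
    let ?n = "2 * N" and ?F = "\<lambda>i k. f i $ k"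
    have f: "f i \<in> carrier_vec N" if "i < ?n" for i
      using frame that by (simp add: unit_norm_2_tight_frame_def)
    have F: "tight2 N ?n ?F" using frame tight2_iff[OF f] by simp
    define G where "G i k = (if k < N then f i $ k else 0)" for i k
    define T where "T v = vec ?n (\<lambda>k. \<Sum>i<?n. v $ i * G i k)" for v
    have Te: "T (unit_vec ?n i) $ k = G i k" if "i < ?n" "k < ?n" for i k
    proof -
      have "(\<Sum>j<?n. unit_vec ?n i $ j * G j k) = (\<Sum>j<?n. of_bool (i = j) * G j k)"
        using that(1) by (intro sum.cong refl) (auto simp: unit_vec_def)
      thus ?thesis unfolding T_def using that by (simp only: index_vec sum_of_bool_left)
    qed
    have pad: "(\<Sum>k<?n. h k) = (\<Sum>k<N. h k)" if "\<And>k. N \<le> k \<Longrightarrow> h k = 0" for h :: "nat \<Rightarrow> real"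
      using that by (intro sum.mono_neutral_right) auto
    have energy: "energy ?n ?n (\<lambda>i k. T (unit_vec ?n i) $ k) x = energy N ?n ?F x" for x
    proof -
      have "energy ?n ?n (\<lambda>i k. T (unit_vec ?n i) $ k) x = energy ?n ?n G x"
        by (simp add: energy_def Te)
      also have "\<dots> = energy N ?n ?F x"
        unfolding energy_def by (subst pad) (auto simp: G_def)
      finally show ?thesis .
    qed
    have T_car: "T v \<in> carrier_vec ?n" for v by (simp add: T_def)
    have lin: "linear_operator ?n T"
      unfolding linear_operator_iff
    proof (intro conjI ballI allI)
      fix v w :: "complex vec" assume "v \<in> carrier_vec ?n" "w \<in> carrier_vec ?n"
      thus "T (v + w) = T v + T w"
        by (intro eq_vecI) (auto simp: T_def distrib_right sum.distrib)
    next
      fix a and v :: "complex vec" assume "v \<in> carrier_vec ?n"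
      thus "T (a \<cdot>\<^sub>v v) = a \<cdot>\<^sub>v T v"
        by (intro eq_vecI) (auto simp: T_def sum_distrib_left mult.assoc)
    qed (rule T_car)
    have "operator_norm ?n T \<le> 2"
      unfolding operator_norm_def
    proof (rule cSUP_least)
      have "hnorm (0\<^sub>v ?n) \<le> 1" by (simp add: hnorm_def)
      thus "{x \<in> carrier_vec ?n. hnorm x \<le> 1} \<noteq> {}" using zero_carrier_vec by blast
      fix v assume "v \<in> {x \<in> carrier_vec ?n. hnorm x \<le> 1}"
      hence v: "v \<in> carrier_vec ?n" "hnorm v \<le> 1" by auto
      have "(hnorm v)\<^sup>2 \<le> 1" using v hnorm_nonneg[of v ?n] by (simp add: power_le_one)
      moreover have "(hnorm (T v))\<^sup>2 \<le> 2 * (hnorm v)\<^sup>2"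
        unfolding hnorm_linear_operator_sq[OF lin v(1)] energy hnorm_sq[OF v(1)]
        by (rule tight2_energy_le[OF F])
      ultimately have "(hnorm (T v))\<^sup>2 \<le> 2\<^sup>2" by simp
      thus "hnorm (T v) \<le> 2" by (rule power2_le_imp_le) simp
    qed
    moreover have "hnorm (T (unit_vec ?n i)) = 1" if "i < ?n" for i
    proof -
      have "sqnorm ?n (($) (T (unit_vec ?n i))) = (\<Sum>k<?n. (cmod (G i k))\<^sup>2)"
        unfolding sqnorm_def by (intro sum.cong refl) (simp add: Te that)
      also have "\<dots> = (\<Sum>k<N. (cmod (G i k))\<^sup>2)" by (rule pad) (simp add: G_def)
      also have "\<dots> = sqnorm N (?F i)" by (simp add: sqnorm_def G_def)
      finally have "sqnorm ?n (($) (T (unit_vec ?n i))) = sqnorm N (?F i)" .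
      thus ?thesis using F that hnorm_eq_1_iff[OF T_car] by (simp add: tight2_def)
    qed
    ultimately have "Rieszable ?n ?n (\<lambda>i. T (unit_vec ?n i)) A r" using lin by (intro r)
    hence "Riesz_colourable ?n ?n (\<lambda>i k. T (unit_vec ?n i) $ k) A r"
      using Rieszable_iff[of ?n "\<lambda>i. T (unit_vec ?n i)" ?n] T_car by blast
    hence "Riesz_colourable N ?n ?F A r"
      unfolding Riesz_colourable_def energy .
    thus ?thesis using Rieszable_iff[of ?n f N] f by blast
  qed
  thus ?thesis using A by blast
qed

text \<open>The Kronecker product with the Fourier matrix of size \<open>K\<close> multiplies the dimension by \<open>K\<close> and bounds
  all coordinates by \<open>1 / \<surd>K\<close>, which is \<open>C / sqrt (2 * N)\<close> for \<open>N = n * K\<close> and \<open>C = sqrt (2 * n)\<close>. The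
  constant \<open>C\<close> depends on the frame, but it does not change with \<open>K\<close>, so \<open>K\<close> can be taken beyond the
  threshold for that \<open>C\<close>.\<close>
lemma flat_frames_imp_all_frames:
  assumes flat: "\<And>C. C > 0 \<Longrightarrow> \<exists>N0. \<forall>N\<ge>N0. \<forall>f. unit_norm_2_tight_frame N (2 * N) f \<and>
       (\<forall>i<2 * N. \<forall>j<N. cmod (f i $ j) \<le> C / sqrt (2 * real N)) \<longrightarrow> Rieszable N (2 * N) f \<delta> r"
    and F: "tight2 n (2 * n) F"
  shows "Riesz_colourable n (2 * n) F \<delta> r"
proof (cases "n = 0")
  case True
  thus ?thesis by (simp add: Riesz_colourable_def sqnorm_def energy_def)
next
  case False
  define C where "C = sqrt (2 * real n)"
  have "C > 0" using False by (simp add: C_def)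
  then obtain N0 where N0: "\<forall>N\<ge>N0. \<forall>f. unit_norm_2_tight_frame N (2 * N) f \<and>
       (\<forall>i<2 * N. \<forall>j<N. cmod (f i $ j) \<le> C / sqrt (2 * real N)) \<longrightarrow> Rieszable N (2 * N) f \<delta> r"
    using flat by meson
  define K where "K = Suc N0"
  have K: "0 < K" by (simp add: K_def)
  let ?N = "n * K" and ?G = "tensor K F (dft K)"
  have "N0 \<le> 1 * K" by (simp add: K_def)
  also have "\<dots> \<le> ?N" using False by (intro mult_right_mono) auto
  finally have N: "N0 \<le> ?N" .
  have two: "2 * n * K = 2 * ?N" by simp
  have G: "tight2 ?N (2 * ?N) ?G"
    using tight2_tensor[OF F unitary_dft[OF K]] by (simp only: two)
  define g where "g i = vec ?N (?G i)" for i
  have g: "g i \<in> carrier_vec ?N" for i by (simp add: g_def)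
  have "tight2 ?N (2 * ?N) (\<lambda>i k. g i $ k)"
  proof -
    have "sqnorm ?N (\<lambda>k. g i $ k) = sqnorm ?N (?G i)" for i
      by (rule sqnorm_cong) (simp add: g_def)
    moreover have "(\<Sum>k<?N. x k * cnj (g i $ k)) = (\<Sum>k<?N. x k * cnj (?G i k))" for i x
      by (rule sum.cong[OF refl]) (simp add: g_def)
    ultimately show ?thesis using G unfolding tight2_def by simp
  qed
  hence "unit_norm_2_tight_frame ?N (2 * ?N) g" using tight2_iff[of "2 * ?N" g ?N] g by blast
  moreover have "cmod (g i $ j) \<le> C / sqrt (2 * real ?N)" if i: "i < 2 * ?N" and j: "j < ?N" for i j
  proof -
    have "i div K < 2 * n" "j div K < n"
      using i j by (auto intro!: less_mult_imp_div_less simp: mult.assoc)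
    hence "(cmod (F (i div K) (j div K)))\<^sup>2 \<le> sqnorm n (F (i div K))"
      unfolding sqnorm_def by (intro member_le_sum) auto
    also have "\<dots> = 1" using F \<open>i div K < 2 * n\<close> by (simp add: tight2_def)
    finally have "cmod (F (i div K) (j div K)) \<le> 1" by (simp add: abs_square_le_1)
    hence "cmod (g i $ j) \<le> 1 / sqrt (real K)"
      using j K by (simp add: g_def tensor_def norm_mult cmod_dft divide_right_mono)
    also have "\<dots> = C / sqrt (2 * real ?N)"
      using False by (simp add: C_def real_sqrt_mult)
    finally show ?thesis .
  qed
  ultimately have "Rieszable ?N (2 * ?N) g \<delta> r" using N0 N by blast
  hence "Riesz_colourable ?N (2 * ?N) (\<lambda>i k. g i $ k) \<delta> r"
    using Rieszable_iff[of "2 * ?N" g ?N] g by blast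
  hence R: "Riesz_colourable ?N (2 * n * K) ?G \<delta> r"
    unfolding Riesz_colourable_def energy_def two by (simp add: g_def)
  have "sqnorm K (dft K 0) = 1" using K by (simp add: sqnorm_def cmod_dft power_divide)
  from Riesz_colourable_of_tensor[OF K this R] show ?thesis .
qed

text \<open>The Gram matrix of \<open>T e\<^sub>i\<close> is \<open>1 + B\<^sup>2 h\<close> for a contraction \<open>h\<close> with zero diagonal. Iterating the
  paving until \<open>B\<^sup>2 \<epsilon> ^ k < 1 / 2\<close> leaves the lower Riesz bound \<open>1 / 2\<close>, whatever \<open>B\<close> is; only
  the number of colours depends on \<open>B\<close>.\<close>
lemma paving_imp_BT:
  assumes P: "one_sided_paving \<epsilon> r" and \<epsilon>: "0 < \<epsilon>" "\<epsilon> < 1"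
  shows "Bourgain_Tzafriri_Conjecture"
  unfolding Bourgain_Tzafriri_Conjecture_def
proof (intro exI[of _ "1 / 2 :: real"] conjI allI impI)
  fix B :: real assume B: "B > 1"
  hence B2: "1 \<le> B\<^sup>2" by (simp add: one_le_power)
  obtain k where k: "\<epsilon> ^ k < 1 / (2 * B\<^sup>2)"
    using real_arch_pow_inv[of "1 / (2 * B\<^sup>2)" \<epsilon>] \<epsilon> B by auto
  show "\<exists>r. \<forall>n T. linear_operator n T \<and> operator_norm n T \<le> B \<and>
      (\<forall>i<n. hnorm (T (unit_vec n i)) = 1) \<longrightarrow> Rieszable n n (\<lambda>i. T (unit_vec n i)) (1 / 2) r"
  proof (intro exI[of _ "(r * r) ^ k"] allI impI)
    fix n T
    assume "linear_operator n T \<and> operator_norm n T \<le> B \<and> (\<forall>i<n. hnorm (T (unit_vec n i)) = 1)"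
    hence T: "linear_operator n T" "operator_norm n T \<le> B" "\<And>i. i < n \<Longrightarrow> hnorm (T (unit_vec n i)) = 1"
      by auto
    let ?F = "\<lambda>i k. T (unit_vec n i) $ k"
    have car: "T (unit_vec n i) \<in> carrier_vec n" for i using T(1) by (simp add: linear_operator_iff)
    define gram where "gram i j = (\<Sum>k<n. ?F i k * cnj (?F j k))" for i j
    define h where "h i j = complex_of_real (1 / B\<^sup>2) * (gram i j - of_bool (i = j))" for i j
    have "qform n gram x = energy n n ?F x" for x
      unfolding energy_def using qform_diagonalized[of n gram "\<lambda>_. 1" ?F n x] by (simp add: gram_def)
    hence q: "qform n h x = (energy n n ?F x - sqnorm n x) / B\<^sup>2" for x
      unfolding h_def by (simp only: qform_scale qform_diff qform_id) simp
    have gram_cnj: "cnj (gram i j) = gram j i" for i j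
      by (simp only: gram_def cnj_sum complex_cnj_mult complex_cnj_cnj mult.commute)
    have "h j i = cnj (h i j)" for i j
      by (cases "i = j") (simp_all add: h_def gram_cnj)
    hence "hermitian n h" unfolding hermitian_def by blast
    moreover have "\<forall>i<n. h i i = 0"
    proof (intro allI impI)
      fix i assume "i < n"
      hence "sqnorm n (?F i) = 1" using T(3) hnorm_eq_1_iff[OF car] by blast
      hence "gram i i = 1" using of_real_sqnorm[of n "?F i"] by (simp add: gram_def)
      thus "h i i = 0" by (simp add: h_def)
    qed
    moreover have "\<forall>x. \<bar>qform n h x\<bar> \<le> sqnorm n x"
    proof
      fix x
      have "0 \<le> energy n n ?F x" by (simp add: energy_def sum_nonneg)
      moreover have "energy n n ?F x \<le> B\<^sup>2 * sqnorm n x"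
        using B by (intro operator_norm_energy_le T) simp
      moreover have "1 * sqnorm n x \<le> B\<^sup>2 * sqnorm n x" using B2 by (intro mult_right_mono) auto
      moreover have "0 \<le> sqnorm n x" by simp
      ultimately have "\<bar>energy n n ?F x - sqnorm n x\<bar> \<le> B\<^sup>2 * sqnorm n x" by linarith
      thus "\<bar>qform n h x\<bar> \<le> sqnorm n x"
        using B by (simp add: q pos_divide_le_eq mult.commute)
    qed
    ultimately obtain c where c: "\<forall>i<n. c i < (r * r) ^ k"
      and cq: "\<And>x. monochromatic n c x \<Longrightarrow> \<bar>qform n h x\<bar> \<le> \<epsilon> ^ k * sqnorm n x"
      using iterate_paving[OF P \<epsilon>(1), of n h k] by blast
    have "1 / 2 * sqnorm n x \<le> energy n n ?F x" if "monochromatic n c x" for x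
    proof -
      have "\<bar>qform n h x\<bar> \<le> 1 / (2 * B\<^sup>2) * sqnorm n x"
        using cq[OF that] k by (meson less_imp_le mult_right_mono order_trans sqnorm_nonneg)
      hence "\<bar>energy n n ?F x - sqnorm n x\<bar> \<le> sqnorm n x / 2"
        using B by (simp add: q field_simps)
      thus ?thesis by linarith
    qed
    hence "Riesz_colourable n n ?F (1 / 2) ((r * r) ^ k)"
      unfolding Riesz_colourable_def using c by blast
    thus "Rieszable n n (\<lambda>i. T (unit_vec n i)) (1 / 2) ((r * r) ^ k)"
      using Rieszable_iff[of n "\<lambda>i. T (unit_vec n i)" n] car by blast
  qed
qed simp

lemma Riesz_colourable_mono:
  assumes "Riesz_colourable N M F \<delta> r" "\<delta>' \<le> \<delta>"
  shows "Riesz_colourable N M F \<delta>' r"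
  using assms unfolding Riesz_colourable_def by (meson mult_right_mono order_trans sqnorm_nonneg)

theorem theorem1p2:
  shows "Bourgain_Tzafriri_Conjecture \<longleftrightarrow>
    (\<exists>\<delta>::real. \<delta> > 0 \<and> (\<exists>r::nat. \<forall>C::real. C > 0 \<longrightarrow> (\<exists>N0::nat. \<forall>N\<ge>N0. \<forall>f :: nat \<Rightarrow> complex vec.
       unit_norm_2_tight_frame N (2 * N) f \<and>
       (\<forall>i<2 * N. \<forall>j<N. cmod (f i $ j) \<le> C / sqrt (2 * real N)) \<longrightarrow>
       Rieszable N (2 * N) f \<delta> r)))"
  (is "?BT \<longleftrightarrow> ?flat")
proof
  assume ?BT
  from BT_imp_tight_frames_Rieszable[OF this] show ?flat by blast
next
  assume ?flat
  then obtain \<delta> r where \<delta>: "\<delta> > 0"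
    and flat: "\<And>C. C > 0 \<Longrightarrow> \<exists>N0. \<forall>N\<ge>N0. \<forall>f. unit_norm_2_tight_frame N (2 * N) f \<and>
       (\<forall>i<2 * N. \<forall>j<N. cmod (f i $ j) \<le> C / sqrt (2 * real N)) \<longrightarrow> Rieszable N (2 * N) f \<delta> r"
    by blast
  \<comment> \<open>the cap keeps the contraction factor \<open>1 - \<delta>'\<close> positive\<close>
  define \<delta>' where "\<delta>' = min \<delta> (1 / 2)"
  have "Riesz_colourable n (2 * n) F \<delta>' r" if "tight2 n (2 * n) F" for n F
    by (rule Riesz_colourable_mono[OF flat_frames_imp_all_frames[OF flat that]]) (simp_all add: \<delta>'_def)
  hence "one_sided_paving (1 - \<delta>') r" by (rule frames_imp_one_sided_paving)
  thus ?BT by (rule paving_imp_BT) (use \<delta> in \<open>auto simp: \<delta>'_def\<close>)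
qed

end
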